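(* Let $E$ be an r.i. space on $[0,1]$ and $1\le q<\infty$. The equivalence $$\|T_qx\|_E\approx\|Ux\|_E+\Big(\frac1n\sum_{k=n+1}^{n^2}(x_k^* )^q\Big)^{1/q},$$ with equivalence constants depending neither on the $n\times n$ matrix $x$ nor on $n$, holds (for all positive integers $n$ and all real $n\times n$ matrices $x$) if and only if there is a constant $C$, independent of $n$ and $y$, such that $$\|T_qy\|_E\le C\,\|Uy\|_E$$ for every $n$ and every diagonal $n\times n$ matrix $y$.
   Context: For a measurable $x$ on $[0,1]$, $x^*(t)$ is the decreasing rearrangement of $|x|$. A Banach space $E$ of measurable functions on $[0,1]$ is rearrangement invariant (r.i.) if $y\in E$ and $x^*\le y^*$ imply $x\in E$ and $\|x\|_E\le\|y\|_E$. Standing assumptions: $\|1\|_E=1$, and $E$ is maximal or minimal in the sense of Lindenstrauss and Tzafriri (e.g. $E$ is separable or isometric to the dual of a separable r.i. space); thus for $x\in E$, $x\ge 0$, $\lim_{t\to\infty}\|\min\{x,t\}\|_E=\|x\|_E$, and $\int_0^\tau x^*\le\int_0^\tau y^*$ for all $\tau\in[0,1]$ implies $\|x\|_E\le\|y\|_E$. For a real $n\times n$ matrix $x=(x_{ij})$, $x_1^*\ge x_2^*\ge\dots\ge x_{n^2}^*$ is the decreasing rearrangement of the numbers $|x_{ij}|$. Let $S_n$ be the group of permutations of $\{1,\dots,n\}$ and $\ell:S_n\to\{1,\dots,n!\}$ a bijection. For $1\le q<\infty$ define the step function on $[0,1)$ $$T_qx(t)=\Big(\sum_{i=1}^n|x_{i,\pi(i)}|^q\Big)^{1/q},\qquad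 t\in\Big[\tfrac{\ell(\pi)-1}{n!},\tfrac{\ell(\pi)}{n!}\Big);$$ $\|T_qx\|_E$ does not depend on $\ell$. Define also $Ux(t)=\sum_{k=1}^n x_k^*\chi_{((k-1)/n,k/n)}(t)$. *)

theory Defs
  imports "HOL-Analysis.Analysis" "Jordan_Normal_Form.Matrix"
begin

abbreviation I01 :: "real measure" where
  "I01 \<equiv> lebesgue_on {0..1}"

(* The infimum is over a nonempty set bounded below whenever t > 0; for t = 0 and essentially
   unbounded x the set is empty and the value is meaningless. By right-continuity nothing is lost
   by comparing rearrangements on the half-open interval from 0 to 1 only. *)
definition decr_rearr :: "(real \<Rightarrow> real) \<Rightarrow> real \<Rightarrow> real" where
  "decr_rearr x t = Inf {s. 0 \<le> s \<and> measure I01 {u \<in> {0..1}. s < \<bar>x u\<bar>} \<le> t}"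

(* A space is a set E of representatives with a norm functional N. Functions are not quotiented by
   almost everywhere equality; values outside the unit interval are irrelevant. *)
locale banach_function_space =
  fixes E :: "(real \<Rightarrow> real) set" and N :: "(real \<Rightarrow> real) \<Rightarrow> real"
  assumes measurable: "E \<subseteq> borel_measurable I01"
    and zero_mem: "(\<lambda>_. 0) \<in> E"
    and add_mem: "\<lbrakk>f \<in> E; g \<in> E\<rbrakk> \<Longrightarrow> (\<lambda>t. f t + g t) \<in> E"
    and scale_mem: "f \<in> E \<Longrightarrow> (\<lambda>t. c * f t) \<in> E"
    and norm_nonneg: "f \<in> E \<Longrightarrow> 0 \<le> N f"
    and norm_eq_0_iff: "f \<in> E \<Longrightarrow> N f = 0 \<longleftrightarrow> (AE t in I01. f t = 0)"
    and norm_triangle: "\<lbrakk>f \<in> E; g \<in> E\<rbrakk> \<Longrightarrow> N (\<lambda>t. f t + g t) \<le> N f + N g"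
    and norm_scale: "f \<in> E \<Longrightarrow> N (\<lambda>t. c * f t) = \<bar>c\<bar> * N f"
    and complete: "\<lbrakk>\<And>k. F k \<in> E;
        \<forall>e>0. \<exists>K. \<forall>m\<ge>K. \<forall>k\<ge>K. N (\<lambda>t. F m t - F k t) < e\<rbrakk>
      \<Longrightarrow> \<exists>f\<in>E. (\<lambda>k. N (\<lambda>t. F k t - f t)) \<longlonglongrightarrow> 0"

locale ri_space = banach_function_space +
  assumes rearr_mem:
      "\<lbrakk>y \<in> E; x \<in> borel_measurable I01; \<forall>t\<in>{0<..1}. decr_rearr x t \<le> decr_rearr y t\<rbrakk> \<Longrightarrow> x \<in> E"
    and rearr_norm_le:
      "\<lbrakk>y \<in> E; x \<in> borel_measurable I01; \<forall>t\<in>{0<..1}. decr_rearr x t \<le> decr_rearr y t\<rbrakk> \<Longrightarrow> N x \<le> N y"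

(* The Koethe dual: the integral functionals in the dual space, with the dual norm. *)
definition assoc_space :: "(real \<Rightarrow> real) set \<Rightarrow> (real \<Rightarrow> real) set" where
  "assoc_space E = {g \<in> borel_measurable I01. \<forall>f\<in>E. integrable I01 (\<lambda>t. f t * g t)}"

definition assoc_norm :: "(real \<Rightarrow> real) set \<Rightarrow> ((real \<Rightarrow> real) \<Rightarrow> real) \<Rightarrow> (real \<Rightarrow> real) \<Rightarrow> real" where
  "assoc_norm E N g = (SUP f \<in> {f \<in> E. N f \<le> 1}. \<bar>\<integral>t. f t * g t \<partial>I01\<bar>)"

definition assoc2_space :: "(real \<Rightarrow> real) set \<Rightarrow> (real \<Rightarrow> real) set" where
  "assoc2_space E = assoc_space (assoc_space E)"

definition assoc2_norm :: "(real \<Rightarrow> real) set \<Rightarrow> ((real \<Rightarrow> real) \<Rightarrow> real) \<Rightarrow> (real \<Rightarrow> real) \<Rightarrow> real" where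
  "assoc2_norm E N = assoc_norm (assoc_space E) (assoc_norm E N)"

(* Lindenstrauss-Tzafriri, Classical Banach Spaces II, Definition 2.a.1: E sits isometrically in its
   second Koethe dual, and is either all of it (maximal) or the closure in it of the simple
   functions (minimal). *)
definition maximal_space :: "(real \<Rightarrow> real) set \<Rightarrow> ((real \<Rightarrow> real) \<Rightarrow> real) \<Rightarrow> bool" where
  "maximal_space E N \<longleftrightarrow> E = assoc2_space E \<and> (\<forall>f\<in>E. N f = assoc2_norm E N f)"

definition minimal_space :: "(real \<Rightarrow> real) set \<Rightarrow> ((real \<Rightarrow> real) \<Rightarrow> real) \<Rightarrow> bool" where
  "minimal_space E N \<longleftrightarrow>
     E = {f \<in> assoc2_space E. \<forall>e>0. \<exists>s \<in> assoc2_space E.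
            simple_function I01 s \<and> assoc2_norm E N (\<lambda>t. f t - s t) < e} \<and>
     (\<forall>f\<in>E. N f = assoc2_norm E N f)"

(* Decreasing rearrangement of the absolute values of the entries, with k counted from 1. *)
definition mat_rearr :: "real mat \<Rightarrow> nat \<Rightarrow> real" where
  "mat_rearr x k =
     rev (sort [\<bar>x $$ (i, j)\<bar>. i \<leftarrow> [0..<dim_row x], j \<leftarrow> [0..<dim_col x]]) ! (k - 1)"

(* For an n x n matrix x and an enumeration l of the permutations of {..<n} by 1, ..., n!.
   Rows and columns are indexed from 0. *)
definition T_op :: "((nat \<Rightarrow> nat) \<Rightarrow> nat) \<Rightarrow> real \<Rightarrow> real mat \<Rightarrow> real \<Rightarrow> real" where
  "T_op l q x t = (let n = dim_row x in
     \<Sum>p | p permutes {..<n}.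
       (\<Sum>i<n. \<bar>x $$ (i, p i)\<bar> powr q) powr (1 / q) *
       indicator {(real (l p) - 1) / fact n ..< real (l p) / fact n} t)"

definition U_op :: "real mat \<Rightarrow> real \<Rightarrow> real" where
  "U_op x t = (let n = dim_row x in
     \<Sum>k=1..n. mat_rearr x k * indicator {(real k - 1) / real n <..< real k / real n} t)"

end

theory Submission
  imports Defs
begin

text \<open>
  Write \<open>a = |x|\<^sup>q\<close> entrywise, so that \<open>T\<^sub>q x = S\<^bsup>1/q\<^esup>\<close> with \<open>S(\<pi>) = \<Sum>\<^sub>i a(i, \<pi> i)\<close>. Norms of step functions
  are compared through their distribution functions only.

  The lower estimate holds in every space. Among \<open>k \<le> n\<close> positions at least one is hit by a random
  permutation with probability at least \<open>k / (2 n)\<close>, by a second moment bound; this controls \<open>U x\<close>. The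
  tail term is controlled by the Paley--Zygmund inequality for the part of \<open>S\<close> coming from the small
  entries.

  For the upper estimate the roughly \<open>n\<close> largest entries are cut into ten blocks of \<open>r \<approx> n/5\<close> entries.
  Reveal one by one whether the positions of a block are hit: whatever the past, the next one is
  hit with probability at most \<open>1 / (4 r)\<close>, whereas for the first \<open>r\<close> diagonal positions of a
  \<open>2 r \<times> 2 r\<close> matrix this probability is at least \<open>1 / (4 r)\<close>. Hence each block is stochastically
  dominated by a diagonal matrix. The remaining entries, after rescaling, are at most \<open>1\<close> and have
  sum at most \<open>n\<close>. Their factorial moments give \<open>P(S \<ge> 17 k) \<le> P(F \<ge> k)\<close> for the number \<open>F\<close> of
  fixed points of a random permutation, and \<open>F\<^bsup>1/q\<^esup>\<close> is the value of \<open>T\<^sub>q\<close> at the identity matrix.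
\<close>

subsection \<open>Counting permutations through given positions\<close>

definition graph_of :: "nat \<Rightarrow> (nat \<Rightarrow> nat) \<Rightarrow> (nat \<times> nat) set" where
  "graph_of n p = (\<lambda>i. (i, p i)) ` {..<n}"

text \<open>Nothing forces \<open>K\<close> to be part of a permutation matrix: two of its positions
  in one row or column make the set empty. Hence \<open>card_hits\<close> and
  \<open>card_hits_avoiding_ge\<close> assume a member.\<close>

definition hits :: "nat \<Rightarrow> (nat \<times> nat) set \<Rightarrow> (nat \<Rightarrow> nat) set" where
  "hits n K = {p. p permutes {..<n} \<and> K \<subseteq> graph_of n p}"

lemma mem_graph_of: "(i, j) \<in> graph_of n p \<longleftrightarrow> i < n \<and> p i = j"
  by (auto simp: graph_of_def)

lemma finite_graph_of [simp]: "finite (graph_of n p)"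
  by (simp add: graph_of_def)

lemma card_graph_of: "card (graph_of n p) = n"
  by (simp add: graph_of_def card_image inj_on_def)

lemma graph_of_subset: "p permutes {..<n} \<Longrightarrow> graph_of n p \<subseteq> {..<n} \<times> {..<n}"
  using permutes_in_image[of p "{..<n}"] by (auto simp: graph_of_def)

lemma finite_hits [simp]: "finite (hits n K)"
  by (rule finite_subset[OF _ finite_permutations[of "{..<n}"]]) (auto simp: hits_def)

text \<open>Composing with the inverse of \<open>p0\<close> turns agreement with \<open>p0\<close>
  on \<open>I\<close> into fixing \<open>I\<close> pointwise, which leaves the permutations of the
  other \<open>n - card I\<close> points.\<close>

lemma card_permutes_agree:
  assumes p0: "p0 permutes {..<n}" and I: "I \<subseteq> {..<n}"
  shows "card {p. p permutes {..<n} \<and> (\<forall>i\<in>I. p i = p0 i)} = fact (n - card I)"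
proof -
  have "bij_betw (\<lambda>p. p0 \<circ> p) {p. p permutes ({..<n} - I)}
          {p. p permutes {..<n} \<and> (\<forall>i\<in>I. p i = p0 i)}"
  proof (rule bij_betw_byWitness[where f' = "\<lambda>p. inv_into UNIV p0 \<circ> p"])
    show "\<forall>p\<in>{p. p permutes {..<n} - I}. inv_into UNIV p0 \<circ> (p0 \<circ> p) = p"
      using permutes_inv_o(2)[OF p0] by (auto simp: o_assoc)
    show "\<forall>p\<in>{p. p permutes {..<n} \<and> (\<forall>i\<in>I. p i = p0 i)}. p0 \<circ> (inv_into UNIV p0 \<circ> p) = p"
      using permutes_inv_o(1)[OF p0] by (auto simp: o_assoc)
    show "(\<lambda>p. p0 \<circ> p) ` {p. p permutes {..<n} - I}
        \<subseteq> {p. p permutes {..<n} \<and> (\<forall>i\<in>I. p i = p0 i)}"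
    proof safe
      fix p assume p: "p permutes {..<n} - I"
      then have "p permutes {..<n}" by (rule permutes_subset) auto
      then show "p0 \<circ> p permutes {..<n}" using p0 by (rule permutes_compose)
      show "(p0 \<circ> p) i = p0 i" if "i \<in> I" for i
        using p that by (simp add: permutes_not_in)
    qed
    show "(\<lambda>p. inv_into UNIV p0 \<circ> p) ` {p. p permutes {..<n} \<and> (\<forall>i\<in>I. p i = p0 i)}
        \<subseteq> {p. p permutes {..<n} - I}"
    proof safe
      fix p assume p: "p permutes {..<n}" and eq: "\<forall>i\<in>I. p i = p0 i"
      have q: "inv_into UNIV p0 \<circ> p permutes {..<n}"
        using p permutes_inv[OF p0] by (rule permutes_compose)
      show "inv_into UNIV p0 \<circ> p permutes {..<n} - I"
      proof (rule permutes_superset[OF q])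
        fix i assume "i \<in> {..<n} - ({..<n} - I)"
        then show "(inv_into UNIV p0 \<circ> p) i = i"
          using eq permutes_inverses(2)[OF p0] by simp
      qed
    qed
  qed
  then have "card {p. p permutes {..<n} \<and> (\<forall>i\<in>I. p i = p0 i)} = card {p. p permutes ({..<n} - I)}"
    by (simp add: bij_betw_same_card)
  also have "\<dots> = fact (n - card I)"
    using I by (intro card_permutations) (auto simp: card_Diff_subset finite_subset)
  finally show ?thesis .
qed

text \<open>Distinct positions of a permutation lie in distinct rows, so passing through
  \<open>K\<close> means agreeing with \<open>p0\<close> on \<open>card K\<close> rows.\<close>

lemma card_hits:
  assumes "p0 \<in> hits n K"
  shows "card (hits n K) = fact (n - card K)"
proof -
  have p0: "p0 permutes {..<n}" and K: "K \<subseteq> graph_of n p0"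
    using assms by (auto simp: hits_def)
  have fst_inj: "inj_on fst K"
    by (rule inj_on_subset[OF _ K]) (auto simp: inj_on_def graph_of_def)
  have "K \<subseteq> graph_of n p \<longleftrightarrow> (\<forall>i\<in>fst ` K. p i = p0 i)" for p
    using K by (fastforce simp: graph_of_def)
  then have "hits n K = {p. p permutes {..<n} \<and> (\<forall>i\<in>fst ` K. p i = p0 i)}"
    by (auto simp: hits_def)
  moreover have "fst ` K \<subseteq> {..<n}" using K by (auto simp: graph_of_def)
  ultimately show ?thesis
    using card_permutes_agree[OF p0, of "fst ` K"] by (simp only: card_image[OF fst_inj])
qed

lemma card_hits_le: "card (hits n K) \<le> fact (n - card K)"
  using card_hits[of _ n K] by (cases "hits n K = {}") auto

text \<open>Union bound: among the permutations through \<open>K\<close>, each position in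
  \<open>Q\<close> excludes at most \<open>fact (n - card K - 1)\<close>.\<close>

lemma card_hits_avoiding_ge:
  assumes p0: "p0 \<in> hits n K" and "finite K" "finite Q" "K \<inter> Q = {}"
  shows "fact (n - card K) - real (card Q) * fact (n - card K - 1)
           \<le> real (card {p \<in> hits n K. Q \<inter> graph_of n p = {}})"
proof -
  have "hits n K \<subseteq> {p \<in> hits n K. Q \<inter> graph_of n p = {}} \<union> (\<Union>z\<in>Q. hits n (insert z K))"
    by (auto simp: hits_def)
  then have "card (hits n K)
      \<le> card ({p \<in> hits n K. Q \<inter> graph_of n p = {}} \<union> (\<Union>z\<in>Q. hits n (insert z K)))"
    using assms(3) by (intro card_mono) auto
  also have "\<dots> \<le> card {p \<in> hits n K. Q \<inter> graph_of n p = {}} + card (\<Union>z\<in>Q. hits n (insert z K))"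
    by (rule card_Un_le)
  also have "card (\<Union>z\<in>Q. hits n (insert z K)) \<le> (\<Sum>z\<in>Q. card (hits n (insert z K)))"
    by (rule card_UN_le[OF assms(3)])
  also have "\<dots> \<le> (\<Sum>z\<in>Q. fact (n - card K - 1))"
  proof (rule sum_mono)
    fix z assume "z \<in> Q"
    then have "z \<notin> K" using assms(4) by auto
    then show "card (hits n (insert z K)) \<le> fact (n - card K - 1)"
      using card_hits_le[of n "insert z K"] \<open>finite K\<close> by simp
  qed
  finally have *: "fact (n - card K) \<le> card {p \<in> hits n K. Q \<inter> graph_of n p = {}}
      + card Q * fact (n - card K - 1)"
    using card_hits[OF p0] by simp
  have "real (fact (n - card K)) \<le> real (card {p \<in> hits n K. Q \<inter> graph_of n p = {}}
      + card Q * fact (n - card K - 1))"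
    using * by (simp only: of_nat_le_iff)
  then show ?thesis by simp
qed

lemma ex_hits_single:
  assumes "i < n" "j < n"
  shows "Transposition.transpose i j \<in> hits n {(i, j)}"
  using assms by (auto simp: hits_def mem_graph_of intro: permutes_swap_id)

lemma card_hits_single:
  assumes "z \<in> {..<n} \<times> {..<n}"
  shows "card (hits n {z}) = fact (n - 1)"
  using assms card_hits[OF ex_hits_single] by (cases z) auto

lemma id_hits: "I \<subseteq> {..<n} \<Longrightarrow> id \<in> hits n ((\<lambda>i. (i, i)) ` I)"
  by (auto simp: hits_def graph_of_def permutes_id)

subsection \<open>Moments of a sum along a permutation\<close>

definition hit_sum :: "nat \<Rightarrow> (nat \<times> nat \<Rightarrow> real) \<Rightarrow> (nat \<Rightarrow> nat) \<Rightarrow> real" where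
  "hit_sum n a p = (\<Sum>z\<in>graph_of n p. a z)"

lemma hit_sum_eq: "hit_sum n a p = (\<Sum>i<n. a (i, p i))"
  unfolding hit_sum_def graph_of_def by (subst sum.reindex) (auto simp: inj_on_def)

lemma hit_sum_indicator:
  assumes "p permutes {..<n}"
  shows "hit_sum n a p = (\<Sum>z\<in>{..<n}\<times>{..<n}. a z * of_bool (z \<in> graph_of n p))"
  unfolding hit_sum_def using graph_of_subset[OF assms]
  by (intro sum.mono_neutral_cong_left) auto

lemma sum_hit_sum:
  "(\<Sum>p | p permutes {..<n}. hit_sum n a p) = fact (n - 1) * (\<Sum>z\<in>{..<n}\<times>{..<n}. a z)"
proof -
  have "(\<Sum>p | p permutes {..<n}. hit_sum n a p)
      = (\<Sum>p | p permutes {..<n}. \<Sum>z\<in>{..<n}\<times>{..<n}. a z * of_bool (z \<in> graph_of n p))"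
    by (rule sum.cong) (auto simp: hit_sum_indicator)
  also have "\<dots> = (\<Sum>z\<in>{..<n}\<times>{..<n}. \<Sum>p | p permutes {..<n}. a z * of_bool (z \<in> graph_of n p))"
    by (rule sum.swap)
  also have "\<dots> = (\<Sum>z\<in>{..<n}\<times>{..<n}. a z * card (hits n {z}))"
    by (rule sum.cong)
      (auto simp: sum_distrib_left[symmetric] hits_def finite_permutations Int_def conj_commute)
  also have "\<dots> = (\<Sum>z\<in>{..<n}\<times>{..<n}. a z * fact (n - 1))"
    by (rule sum.cong) (simp_all add: card_hits_single)
  finally show ?thesis
    unfolding sum_distrib_left by (simp add: mult.commute)
qed

text \<open>Expanding the square gives pairs of positions. Equal ones lie on
  \<open>fact (n - 1)\<close> permutations, different ones on at most \<open>fact (n - 2)\<close>,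
  and on none if they share a row or column.\<close>

lemma sum_hit_sum_sq:
  assumes a: "\<And>z. 0 \<le> a z"
  shows "(\<Sum>p | p permutes {..<n}. (hit_sum n a p)\<^sup>2)
    \<le> fact (n - 1) * (\<Sum>z\<in>{..<n}\<times>{..<n}. (a z)\<^sup>2)
      + fact (n - 2) * ((\<Sum>z\<in>{..<n}\<times>{..<n}. a z)\<^sup>2 - (\<Sum>z\<in>{..<n}\<times>{..<n}. (a z)\<^sup>2))"
proof -
  let ?P = "{..<n} \<times> {..<n}"
  have "(\<Sum>p | p permutes {..<n}. (hit_sum n a p)\<^sup>2)
      = (\<Sum>p | p permutes {..<n}. \<Sum>z\<in>?P. \<Sum>w\<in>?P. a z * a w * of_bool ({z, w} \<subseteq> graph_of n p))"
  proof (rule sum.cong[OF refl])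
    fix p assume "p \<in> {p. p permutes {..<n}}"
    then have *: "hit_sum n a p = (\<Sum>z\<in>?P. a z * of_bool (z \<in> graph_of n p))"
      by (simp add: hit_sum_indicator)
    show "(hit_sum n a p)\<^sup>2
        = (\<Sum>z\<in>?P. \<Sum>w\<in>?P. a z * a w * of_bool ({z, w} \<subseteq> graph_of n p))"
      unfolding * power2_eq_square sum_product by (intro sum.cong refl) simp
  qed
  also have "\<dots> = (\<Sum>z\<in>?P. \<Sum>p | p permutes {..<n}. \<Sum>w\<in>?P. a z * a w * of_bool ({z, w} \<subseteq> graph_of n p))"
    by (rule sum.swap)
  also have "\<dots> = (\<Sum>z\<in>?P. \<Sum>w\<in>?P. \<Sum>p | p permutes {..<n}. a z * a w * of_bool ({z, w} \<subseteq> graph_of n p))"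
    by (rule sum.cong[OF refl], rule sum.swap)
  also have "\<dots> = (\<Sum>z\<in>?P. \<Sum>w\<in>?P. a z * a w * card (hits n {z, w}))"
    by (intro sum.cong refl)
      (auto simp: sum_distrib_left[symmetric] hits_def finite_permutations Int_def conj_commute)
  also have "\<dots> \<le> (\<Sum>z\<in>?P. \<Sum>w\<in>?P. a z * a w * (if z = w then fact (n - 1) else fact (n - 2)))"
  proof (intro sum_mono mult_left_mono)
    fix z w
    have "real (card (hits n {z, w})) \<le> real (fact (n - card {z, w}))"
      using card_hits_le by (simp only: of_nat_le_iff)
    then show "real (card (hits n {z, w})) \<le> (if z = w then fact (n - 1) else fact (n - 2))"
      by (cases "z = w") (simp_all add: numeral_2_eq_2)
  qed (use a in auto)
  \<comment> \<open>The weight \<open>fact (n - 2)\<close> goes to all pairs, which then form a full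
    square; the diagonal is corrected separately.\<close>
  also have "\<dots> = (\<Sum>z\<in>?P. \<Sum>w\<in>?P. fact (n - 2) * (a z * a w)
      + (if z = w then (fact (n - 1) - fact (n - 2)) * (a z)\<^sup>2 else 0))"
    by (intro sum.cong refl) (auto simp: algebra_simps power2_eq_square)
  also have "\<dots> = fact (n - 2) * (\<Sum>z\<in>?P. a z)\<^sup>2
      + (fact (n - 1) - fact (n - 2)) * (\<Sum>z\<in>?P. (a z)\<^sup>2)"
  proof -
    have "(\<Sum>w\<in>?P. if z = w then (fact (n - 1) - fact (n - 2)) * (a z)\<^sup>2 else 0)
        = (fact (n - 1) - fact (n - 2)) * (a z)\<^sup>2" if "z \<in> ?P" for z
      using that by (subst sum.delta') auto
    then have "(\<Sum>z\<in>?P. \<Sum>w\<in>?P. fact (n - 2) * (a z * a w)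
          + (if z = w then (fact (n - 1) - fact (n - 2)) * (a z)\<^sup>2 else 0))
        = (\<Sum>z\<in>?P. \<Sum>w\<in>?P. fact (n - 2) * (a z * a w))
          + (\<Sum>z\<in>?P. (fact (n - 1) - fact (n - 2)) * (a z)\<^sup>2)"
      unfolding sum.distrib by simp
    also have "(\<Sum>z\<in>?P. \<Sum>w\<in>?P. fact (n - 2) * (a z * a w)) = fact (n - 2) * (\<Sum>z\<in>?P. a z)\<^sup>2"
      unfolding power2_eq_square sum_product by (simp only: sum_distrib_left)
    finally show ?thesis by (simp only: sum_distrib_left)
  qed
  finally show ?thesis by (simp add: algebra_simps)
qed

text \<open>\<open>k!\<close> times the elementary symmetric polynomial: a sum over \<open>k\<close>-tuples of distinct elements.\<close>

primrec esum :: "nat \<Rightarrow> ('a \<Rightarrow> real) \<Rightarrow> 'a set \<Rightarrow> real" where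
  "esum 0 b A = 1"
| "esum (Suc k) b A = (\<Sum>z\<in>A. b z * esum k b (A - {z}))"

lemma esum_nonneg: "(\<And>z. 0 \<le> b z) \<Longrightarrow> 0 \<le> esum k b A"
  by (induction k arbitrary: A) (auto intro!: sum_nonneg)

text \<open>Choose the \<open>k\<close> elements one after another: each removal lowers the total by
  at most 1, so every choice still has at least \<open>sum b A - k\<close> available.\<close>

lemma esum_ge:
  assumes "finite A" "\<And>z. 0 \<le> b z" "\<And>z. b z \<le> 1" "real k \<le> sum b A"
  shows "(sum b A - k) ^ k \<le> esum k b A"
  using assms
proof (induction k arbitrary: A)
  case (Suc k)
  let ?S = "sum b A"
  have "(?S - Suc k) ^ Suc k \<le> ?S * (?S - Suc k) ^ k"
    using Suc.prems by (auto intro!: mult_right_mono)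
  also have "\<dots> = (\<Sum>z\<in>A. b z * (?S - Suc k) ^ k)"
    by (simp add: sum_distrib_right)
  also have "\<dots> \<le> (\<Sum>z\<in>A. b z * esum k b (A - {z}))"
  proof (intro sum_mono mult_left_mono)
    fix z assume z: "z \<in> A"
    have S: "sum b (A - {z}) = ?S - b z"
      using z Suc.prems(1) by (simp add: sum_diff1)
    have b1: "real k \<le> sum b (A - {z})" "?S - Suc k \<le> sum b (A - {z}) - k"
      using Suc.prems(3)[of z] Suc.prems(4) by (simp_all add: S)
    have "(?S - Suc k) ^ k \<le> (sum b (A - {z}) - k) ^ k"
      using Suc.prems(4) b1 by (intro power_mono) auto
    also have "\<dots> \<le> esum k b (A - {z})"
      using Suc.prems b1 by (intro Suc.IH) auto
    finally show "(?S - Suc k) ^ k \<le> esum k b (A - {z})" .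
  qed (use Suc.prems in auto)
  finally show ?case by simp
qed simp

text \<open>A factorial moment of the hit sum; the case of interest is \<open>K = {}\<close>.
  Choosing one more hit position \<open>z\<close> replaces \<open>K\<close> by
  \<open>insert z K\<close>, so the induction runs over arbitrary \<open>K\<close>.\<close>

lemma sum_esum_hits_le:
  assumes b: "\<And>z. 0 \<le> b z" and "finite K"
  shows "(\<Sum>p\<in>hits n K. esum k b (graph_of n p - K))
    \<le> fact (n - card K - k) * (\<Sum>z\<in>{..<n}\<times>{..<n}. b z) ^ k"
  using assms(2)
proof (induction k arbitrary: K)
  case 0
  have "real (card (hits n K)) \<le> real (fact (n - card K))"
    using card_hits_le by (simp only: of_nat_le_iff)
  then show ?case by simp
next
  case (Suc k)
  let ?P = "{..<n} \<times> {..<n}" and ?B = "\<Sum>z\<in>{..<n}\<times>{..<n}. b z"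
  have "(\<Sum>p\<in>hits n K. esum (Suc k) b (graph_of n p - K))
      = (\<Sum>p\<in>hits n K. \<Sum>z\<in>?P - K.
           if z \<in> graph_of n p then b z * esum k b (graph_of n p - insert z K) else 0)"
  proof (rule sum.cong[OF refl])
    fix p assume "p \<in> hits n K"
    then have "graph_of n p \<subseteq> ?P" by (intro graph_of_subset) (simp add: hits_def)
    moreover have "graph_of n p - K - {z} = graph_of n p - insert z K" for z by auto
    ultimately show "esum (Suc k) b (graph_of n p - K) = (\<Sum>z\<in>?P - K.
           if z \<in> graph_of n p then b z * esum k b (graph_of n p - insert z K) else 0)"
      unfolding esum.simps by (intro sum.mono_neutral_cong_left) (auto split: if_splits)
  qed
  also have "\<dots> = (\<Sum>z\<in>?P - K. \<Sum>p\<in>hits n K.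
           if z \<in> graph_of n p then b z * esum k b (graph_of n p - insert z K) else 0)"
    by (rule sum.swap)
  also have "\<dots> = (\<Sum>z\<in>?P - K. b z * (\<Sum>p\<in>hits n (insert z K). esum k b (graph_of n p - insert z K)))"
    unfolding sum_distrib_left
    by (intro sum.cong[OF refl] sum.mono_neutral_cong_right) (auto simp: hits_def finite_permutations)
  also have "\<dots> \<le> (\<Sum>z\<in>?P - K. b z * (fact (n - card K - Suc k) * ?B ^ k))"
  proof (intro sum_mono mult_left_mono b)
    fix z assume "z \<in> ?P - K"
    then show "(\<Sum>p\<in>hits n (insert z K). esum k b (graph_of n p - insert z K))
        \<le> fact (n - card K - Suc k) * ?B ^ k"
      using Suc.IH[of "insert z K"] Suc.prems by simp
  qed
  also have "\<dots> = sum b (?P - K) * (fact (n - card K - Suc k) * ?B ^ k)"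
    by (simp add: sum_distrib_right)
  also have "\<dots> \<le> ?B * (fact (n - card K - Suc k) * ?B ^ k)"
    by (intro mult_right_mono sum_mono2 mult_nonneg_nonneg zero_le_power sum_nonneg)
      (auto simp: b)
  finally show ?case by (simp add: algebra_simps)
qed

section \<open>Tails of hit sums compared with the number of fixed points\<close>

text \<open>Markov's inequality for the \<open>k\<close>-th factorial moment: where the hit sum is
  at least \<open>17 * k\<close>, \<open>esum_ge\<close> subtracts \<open>k\<close> and leaves
  \<open>(16 * k) ^ k\<close>.\<close>

lemma card_hit_sum_tail:
  fixes b :: "nat \<times> nat \<Rightarrow> real"
  assumes b: "\<And>z. 0 \<le> b z" "\<And>z. b z \<le> 1" and B: "(\<Sum>z\<in>{..<n}\<times>{..<n}. b z) \<le> n"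
  shows "real (card {p. p permutes {..<n} \<and> 17 * real k \<le> hit_sum n b p}) * (16 * real k) ^ k
    \<le> fact (n - k) * real n ^ k"
proof -
  let ?A = "{p. p permutes {..<n} \<and> 17 * real k \<le> hit_sum n b p}"
  have "real (card ?A) * (16 * real k) ^ k = (\<Sum>p\<in>?A. (16 * real k) ^ k)" by simp
  also have "\<dots> \<le> (\<Sum>p\<in>?A. esum k b (graph_of n p))"
  proof (rule sum_mono)
    fix p assume p: "p \<in> ?A"
    then have "(16 * real k) ^ k \<le> (sum b (graph_of n p) - k) ^ k"
      by (intro power_mono) (auto simp: hit_sum_def)
    also have "\<dots> \<le> esum k b (graph_of n p)"
      using p b by (intro esum_ge) (auto simp: hit_sum_def)
    finally show "(16 * real k) ^ k \<le> esum k b (graph_of n p)" .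
  qed
  also have "\<dots> \<le> (\<Sum>p\<in>hits n {}. esum k b (graph_of n p))"
    by (intro sum_mono2 esum_nonneg b) (auto simp: hits_def finite_permutations)
  also have "\<dots> \<le> fact (n - k) * (\<Sum>z\<in>{..<n}\<times>{..<n}. b z) ^ k"
    using sum_esum_hits_le[of b "{}" k n] b by simp
  also have "\<dots> \<le> fact (n - k) * real n ^ k"
    using B by (intro mult_left_mono power_mono sum_nonneg b) auto
  finally show ?thesis .
qed

text \<open>Prescribe the set of fixed points below \<open>r\<close> to be a \<open>k\<close>-set
  \<open>I\<close>; different \<open>I\<close> give disjoint events. By the union bound each has at
  least \<open>fact (n - k) - (r - k) * fact (n - k - 1)\<close> elements, which equals
  \<open>(n - r) * fact (n - k - 1)\<close>.\<close>

lemma card_fixpoints_ge: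
  assumes "k \<le> r" "r < n"
  shows "real (r choose k) * (real (n - r) * fact (n - k - 1))
    \<le> real (card {p. p permutes {..<n} \<and> k \<le> card {i. i < n \<and> p i = i}})"
proof -
  let ?D = "\<lambda>I. (\<lambda>i::nat. (i, i)) ` I"
  let ?S = "{I. I \<subseteq> {..<r} \<and> card I = k}"
  let ?F = "\<lambda>I. {p \<in> hits n (?D I). ?D ({..<r} - I) \<inter> graph_of n p = {}}"
  have fin: "finite ?S" by (rule finite_subset[of _ "Pow {..<r}"]) auto
  have F: "real (n - r) * fact (n - k - 1) \<le> real (card (?F I))" if I: "I \<in> ?S" for I
  proof -
    have cI: "card (?D I) = k" "card (?D ({..<r} - I)) = r - k" "finite I"
      using I finite_subset[of I "{..<r}"]
      by (auto simp: card_image inj_on_def card_Diff_subset)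
    have "fact (n - k) - real (r - k) * fact (n - k - 1) \<le> real (card (?F I))"
    proof -
      have "I \<subseteq> {..<n}" using I assms by auto
      then have "fact (n - card (?D I)) - real (card (?D ({..<r} - I))) * fact (n - card (?D I) - 1)
          \<le> real (card (?F I))"
        using cI(3) by (intro card_hits_avoiding_ge[OF id_hits]) auto
      then show ?thesis unfolding cI(1,2) .
    qed
    moreover have "fact (n - k) = real (n - k) * fact (n - k - 1)"
      using assms by (intro fact_reduce) auto
    ultimately show ?thesis
      using assms by (simp add: of_nat_diff algebra_simps)
  qed
  have I_eq: "I = {i. i < r \<and> p i = i}" if "p \<in> ?F I" "I \<in> ?S" for I p
    using that assms by (fastforce simp: hits_def mem_graph_of)
  have "real (r choose k) * (real (n - r) * fact (n - k - 1)) = (\<Sum>I\<in>?S. real (n - r) * fact (n - k - 1))"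
    using n_subsets[of "{..<r}" k] by simp
  also have "\<dots> \<le> (\<Sum>I\<in>?S. real (card (?F I)))"
    by (rule sum_mono) (rule F)
  also have "\<dots> = real (card (\<Union>I\<in>?S. ?F I))"
  proof -
    have "card (\<Union>I\<in>?S. ?F I) = (\<Sum>I\<in>?S. card (?F I))"
    proof (rule card_UN_disjoint[OF fin])
      show "\<forall>I\<in>?S. finite (?F I)"
        by (intro ballI finite_subset[OF _ finite_hits]) (rule Collect_restrict)
      show "\<forall>I\<in>?S. \<forall>J\<in>?S. I \<noteq> J \<longrightarrow> ?F I \<inter> ?F J = {}"
      proof (intro ballI impI equals0I)
        fix I J p assume IJ: "I \<in> ?S" "J \<in> ?S" "I \<noteq> J" and p: "p \<in> ?F I \<inter> ?F J"
        have "I = {i. i < r \<and> p i = i}" using p IJ(1) by (intro I_eq) (erule IntD1)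
        moreover have "J = {i. i < r \<and> p i = i}" using p IJ(2) by (intro I_eq) (erule IntD2)
        ultimately show False using IJ(3) by simp
      qed
    qed
    then show ?thesis by simp
  qed
  also have "\<dots> \<le> real (card {p. p permutes {..<n} \<and> k \<le> card {i. i < n \<and> p i = i}})"
  proof (intro of_nat_mono card_mono subsetI)
    fix p assume "p \<in> (\<Union>I\<in>?S. ?F I)"
    then obtain I where I: "I \<in> ?S" "p \<in> ?F I" by blast
    then have "I \<subseteq> {i. i < n \<and> p i = i}" by (auto simp: hits_def mem_graph_of)
    then have "card I \<le> card {i. i < n \<and> p i = i}" by (intro card_mono) auto
    then show "p \<in> {p. p permutes {..<n} \<and> k \<le> card {i. i < n \<and> p i = i}}"
      using I by (auto simp: hits_def)
  qed (simp add: finite_permutations)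
  finally show ?thesis .
qed

text \<open>For \<open>1 \<le> k\<close> and \<open>17 * k \<le> n\<close> compare both counts with
  \<open>fact (n - k)\<close>: the left one is at most \<open>(n / (16 * k)) ^ k\<close> times it,
  the right one at least half of \<open>(n / (4 * k)) ^ k\<close> times it, and
  \<open>2 \<le> 4 ^ k\<close>.\<close>

lemma card_hit_sum_le_fixpoints:
  fixes b :: "nat \<times> nat \<Rightarrow> real"
  assumes b: "\<And>z. 0 \<le> b z" "\<And>z. b z \<le> 1" and B: "(\<Sum>z\<in>{..<n}\<times>{..<n}. b z) \<le> n"
  shows "card {p. p permutes {..<n} \<and> 17 * real k \<le> hit_sum n b p}
    \<le> card {p. p permutes {..<n} \<and> k \<le> card {i. i < n \<and> p i = i}}" (is "?L \<le> ?R")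
proof -
  have "hit_sum n b p \<le> n" for p
    using sum_mono[of "graph_of n p" b "\<lambda>_. 1"] b(2) by (simp add: hit_sum_def card_graph_of)
  then have empty: "?L = 0" if "n < 17 * k"
  proof -
    have "\<not> 17 * real k \<le> hit_sum n b p" for p
      using \<open>hit_sum n b p \<le> n\<close> that by linarith
    then show ?thesis by simp
  qed
  consider "k = 0" | "n < 17 * k" | "1 \<le> k" "17 * k \<le> n" by linarith
  then show ?thesis
  proof cases
    case 1
    then show ?thesis by (intro card_mono) (auto simp: finite_permutations)
  next
    case 2
    with empty show ?thesis by simp
  next
    case 3
    \<comment> \<open>With half of \<open>n\<close>, the binomial coefficient loses only a factor
      \<open>4 ^ k\<close> and the factor \<open>n - r\<close> only 2.\<close>
    define r where "r = n div 2"
    have r: "k \<le> r" "r < n" "real n \<le> 2 * real (n - r)" "real n \<le> 4 * real r"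
      using 3 by (auto simp: r_def)
    have k0: "real k > 0" using 3 by simp
    have n0: "real n > 0" using 3 by simp
    have f: "fact (n - k) = real (n - k) * fact (n - k - 1)"
      using 3 by (intro fact_reduce) auto
    have "real ?L * (16 * real k) ^ k \<le> fact (n - k) * real n ^ k"
      using card_hit_sum_tail[OF b B] .
    also have "\<dots> \<le> fact (n - k) * (4 * real r) ^ k"
      using r by (intro mult_left_mono power_mono) auto
    also have "\<dots> \<le> (2 * real (n - r) * fact (n - k - 1)) * (4 * real r) ^ k"
      unfolding f using r 3 by (intro mult_right_mono) auto
    also have "\<dots> = (real r / real k) ^ k * (real (n - r) * fact (n - k - 1)) * (2 * (4 * real k) ^ k)"
      using k0 by (simp add: power_mult_distrib power_divide)
    also have "\<dots> \<le> real (r choose k) * (real (n - r) * fact (n - k - 1)) * (2 * (4 * real k) ^ k)"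
      using binomial_ge_n_over_k_pow_k[OF r(1)] by (intro mult_right_mono) auto
    also have "\<dots> \<le> real ?R * (2 * (4 * real k) ^ k)"
      using card_fixpoints_ge[OF r(1,2)] by (intro mult_right_mono) auto
    also have "\<dots> \<le> real ?R * (16 * real k) ^ k"
    proof (intro mult_left_mono)
      have "(2::real) \<le> 4 ^ k" using power_increasing[OF 3(1), of "4::real"] by simp
      then have "2 * (4 * real k) ^ k \<le> 4 ^ k * (4 * real k) ^ k"
        by (intro mult_right_mono) auto
      also have "\<dots> = (16 * real k) ^ k" by (subst power_mult_distrib[symmetric]) simp
      finally show "2 * (4 * real k) ^ k \<le> (16 * real k) ^ k" .
    qed simp
    finally have "real ?L \<le> real ?R"
      using k0 by (simp add: mult_le_cancel_right)
    then show ?thesis by simp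
  qed
qed

subsection \<open>Domination of sequentially revealed events\<close>

text \<open>The expectation of \<open>f\<close> at a random subset of \<open>{..<r}\<close> that contains each element
  independently with probability \<open>h\<close>: it interpolates between the two histories compared below.\<close>

primrec bern :: "real \<Rightarrow> nat \<Rightarrow> (nat set \<Rightarrow> real) \<Rightarrow> real" where
  "bern h 0 f = f {}"
| "bern h (Suc r) f = bern h r (\<lambda>K. h * f (insert r K) + (1 - h) * f K)"

text \<open>\<open>A\<close> is a sequence of events on sample points \<open>w\<close>; fixing
  \<open>history A j w = K\<close> conditions on the complete outcome of the first \<open>j\<close>
  of them.\<close>

definition history :: "(nat \<Rightarrow> 'a \<Rightarrow> bool) \<Rightarrow> nat \<Rightarrow> 'a \<Rightarrow> nat set" where
  "history A j w = {i. i < j \<and> A i w}"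

lemma history_Suc: "history A (Suc j) w = (if A j w then insert j (history A j w) else history A j w)"
  by (auto simp: history_def less_Suc_eq)

text \<open>Event \<open>j\<close> enters only through its count within each history, multiplied by
  \<open>f (insert j K) - f K\<close>. For monotone \<open>f\<close> this factor is nonnegative, so
  bounds on conditional probabilities carry over.\<close>

lemma sum_history_Suc:
  fixes f :: "nat set \<Rightarrow> real"
  assumes "finite W"
  shows "(\<Sum>w\<in>W. f (history A (Suc j) w))
    = (\<Sum>K\<in>Pow {..<j}. real (card {w\<in>W. history A j w = K \<and> A j w}) * (f (insert j K) - f K)
        + real (card {w\<in>W. history A j w = K}) * f K)"
proof -
  have "(\<Sum>w\<in>W. f (history A (Suc j) w))
      = (\<Sum>K\<in>Pow {..<j}. \<Sum>w\<in>{w\<in>W. history A j w = K}. f (history A (Suc j) w))"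
    using assms by (intro sum.group[symmetric]) (auto simp: history_def)
  also have "\<dots> = (\<Sum>K\<in>Pow {..<j}. \<Sum>w\<in>{w\<in>W. history A j w = K}.
        of_bool (A j w) * (f (insert j K) - f K) + f K)"
    by (intro sum.cong refl) (auto simp: history_Suc)
  also have "\<dots> = (\<Sum>K\<in>Pow {..<j}. real (card {w\<in>W. history A j w = K \<and> A j w}) * (f (insert j K) - f K)
        + real (card {w\<in>W. history A j w = K}) * f K)"
    using assms
    by (intro sum.cong refl) (auto simp: sum.distrib sum_distrib_right[symmetric] Int_def conj_assoc)
  finally show ?thesis .
qed

lemma sum_history:
  fixes g :: "nat set \<Rightarrow> real"
  assumes "finite W"
  shows "(\<Sum>w\<in>W. g (history A j w)) = (\<Sum>K\<in>Pow {..<j}. real (card {w\<in>W. history A j w = K}) * g K)"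
proof -
  have "(\<Sum>w\<in>W. g (history A j w)) = (\<Sum>K\<in>Pow {..<j}. \<Sum>w\<in>{w\<in>W. history A j w = K}. g (history A j w))"
    using assms by (intro sum.group[symmetric]) (auto simp: history_def)
  also have "\<dots> = (\<Sum>K\<in>Pow {..<j}. real (card {w\<in>W. history A j w = K}) * g K)"
    by (intro sum.cong refl) auto
  finally show ?thesis .
qed

lemma mono_bern_step:
  fixes f :: "nat set \<Rightarrow> real"
  assumes "mono f" "0 \<le> h" "h \<le> 1"
  shows "mono (\<lambda>K. h * f (insert r K) + (1 - h) * f K)"
  using assms by (intro monoI add_mono mult_left_mono) (auto intro: monoD)

text \<open>If no conditional probability exceeds \<open>h\<close>, the last event can be exchanged
  for an independent coin, which replaces \<open>f\<close> by its average over the coin. That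
  average is again monotone, so the induction continues.\<close>

lemma sum_history_le_bern:
  fixes f :: "nat set \<Rightarrow> real" and h :: real
  assumes "finite W" "0 \<le> h" "h \<le> 1" "mono f"
    and "\<And>j K. j < r \<Longrightarrow> K \<subseteq> {..<j} \<Longrightarrow>
      real (card {w\<in>W. history A j w = K \<and> A j w}) \<le> h * card {w\<in>W. history A j w = K}"
  shows "(\<Sum>w\<in>W. f (history A r w)) \<le> card W * bern h r f"
  using assms(4,5)
proof (induction r arbitrary: f)
  case 0
  then show ?case by (simp add: history_def)
next
  case (Suc r)
  have "(\<Sum>w\<in>W. f (history A (Suc r) w))
      \<le> (\<Sum>K\<in>Pow {..<r}. h * card {w\<in>W. history A r w = K} * (f (insert r K) - f K)
        + real (card {w\<in>W. history A r w = K}) * f K)"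
    unfolding sum_history_Suc[OF assms(1)]
    using Suc.prems by (intro sum_mono add_right_mono mult_right_mono) (auto intro: monoD)
  also have "\<dots> = (\<Sum>K\<in>Pow {..<r}. real (card {w\<in>W. history A r w = K})
      * (h * f (insert r K) + (1 - h) * f K))"
    by (intro sum.cong refl) (simp add: algebra_simps)
  also have "\<dots> = (\<Sum>w\<in>W. h * f (insert r (history A r w)) + (1 - h) * f (history A r w))"
    using sum_history[OF assms(1), where g = "\<lambda>K. h * f (insert r K) + (1 - h) * f K" and A = A and j = r]
    by simp
  also have "\<dots> \<le> card W * bern h r (\<lambda>K. h * f (insert r K) + (1 - h) * f K)"
    using Suc.prems(1) by (intro Suc.IH mono_bern_step assms Suc.prems(2)) auto
  finally show ?case by simp
qed

text \<open>The same exchange of the last event for a coin, with conditional probabilities at least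
  \<open>h\<close>.\<close>

lemma sum_history_ge_bern:
  fixes f :: "nat set \<Rightarrow> real" and h :: real
  assumes "finite W" "0 \<le> h" "h \<le> 1" "mono f"
    and "\<And>j K. j < r \<Longrightarrow> K \<subseteq> {..<j} \<Longrightarrow>
      h * card {w\<in>W. history A j w = K} \<le> real (card {w\<in>W. history A j w = K \<and> A j w})"
  shows "card W * bern h r f \<le> (\<Sum>w\<in>W. f (history A r w))"
  using assms(4,5)
proof (induction r arbitrary: f)
  case 0
  then show ?case by (simp add: history_def)
next
  case (Suc r)
  have "card W * bern h (Suc r) f
      \<le> (\<Sum>w\<in>W. h * f (insert r (history A r w)) + (1 - h) * f (history A r w))"
    unfolding bern.simps using Suc.prems(1) by (intro Suc.IH mono_bern_step assms Suc.prems(2)) auto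
  also have "\<dots> = (\<Sum>K\<in>Pow {..<r}. real (card {w\<in>W. history A r w = K})
      * (h * f (insert r K) + (1 - h) * f K))"
    using sum_history[OF assms(1), where g = "\<lambda>K. h * f (insert r K) + (1 - h) * f K" and A = A and j = r]
    by simp
  also have "\<dots> = (\<Sum>K\<in>Pow {..<r}. h * card {w\<in>W. history A r w = K} * (f (insert r K) - f K)
        + real (card {w\<in>W. history A r w = K}) * f K)"
    by (intro sum.cong refl) (simp add: algebra_simps)
  also have "\<dots> \<le> (\<Sum>w\<in>W. f (history A (Suc r) w))"
    unfolding sum_history_Suc[OF assms(1)]
    using Suc.prems by (intro sum_mono add_right_mono mult_right_mono) (auto intro: monoD)
  finally show ?case .
qed

text \<open>The value \<open>1 / (4 * r)\<close> separates the two sides. Given a possible past with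
  \<open>m\<close> hits, at most \<open>fact (n - m - 1)\<close> of at least
  \<open>(n - j) * fact (n - m - 1)\<close> permutations hit position \<open>j\<close>, and
  \<open>4 * r < n - j\<close>. On the diagonal it is at least
  \<open>r * fact (2 * r - m - 2)\<close> of at most
  \<open>4 * r * r * fact (2 * r - m - 2)\<close>.\<close>

lemma block_dominated_by_diagonal:
  fixes pos :: "nat \<Rightarrow> nat \<times> nat" and d :: "nat \<Rightarrow> real"
  assumes r: "1 \<le> r" "5 * r \<le> n" and inj: "inj_on pos {..<r}" and d: "\<And>j. 0 \<le> d j"
  shows "real (card {p. p permutes {..<n} \<and> u < (\<Sum>j | j < r \<and> pos j \<in> graph_of n p. d j)}) / fact n
    \<le> real (card {p. p permutes {..<2 * r} \<and> u < (\<Sum>j | j < r \<and> p j = j. d j)}) / fact (2 * r)"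
proof -
  \<comment> \<open>The intersection with \<open>{..<r}\<close> keeps the sum finite; a sum over an
    infinite set is 0, which would spoil monotonicity on all sets.\<close>
  define f :: "nat set \<Rightarrow> real" where "f K = of_bool (u < (\<Sum>j\<in>K \<inter> {..<r}. d j))" for K
  have "mono f"
  proof (rule monoI)
    fix K L :: "nat set" assume "K \<subseteq> L"
    then have "(\<Sum>j\<in>K \<inter> {..<r}. d j) \<le> (\<Sum>j\<in>L \<inter> {..<r}. d j)"
      using d by (intro sum_mono2) auto
    then show "f K \<le> f L" by (auto simp: f_def)
  qed
  define h :: real where "h = 1 / (4 * real r)"
  have h: "0 \<le> h" "h \<le> 1" using r by (auto simp: h_def)
  define A where "A j p \<longleftrightarrow> pos j \<in> graph_of n p" for j p
  define B where "B j p \<longleftrightarrow> p j = j" for j and p :: "nat \<Rightarrow> nat"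
  have sumA: "(\<Sum>p | p permutes {..<n}. f (history A r p))
      = real (card {p. p permutes {..<n} \<and> u < (\<Sum>j | j < r \<and> pos j \<in> graph_of n p. d j)})"
  proof -
    have "history A r p \<inter> {..<r} = {j. j < r \<and> pos j \<in> graph_of n p}" for p
      by (auto simp: history_def A_def)
    then show ?thesis by (simp add: f_def finite_permutations Int_def)
  qed
  have sumB: "(\<Sum>p | p permutes {..<2 * r}. f (history B r p))
      = real (card {p. p permutes {..<2 * r} \<and> u < (\<Sum>j | j < r \<and> p j = j. d j)})"
  proof -
    have "history B r p \<inter> {..<r} = {j. j < r \<and> p j = j}" for p
      by (auto simp: history_def B_def)
    then show ?thesis by (simp add: f_def finite_permutations Int_def)
  qed
  have "(\<Sum>p | p permutes {..<n}. f (history A r p)) \<le> card {p. p permutes {..<n}} * bern h r f"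
  proof (rule sum_history_le_bern[OF _ h \<open>mono f\<close>])
    fix j K assume j: "j < r" and K: "K \<subseteq> {..<j}"
    let ?X = "{p \<in> {p. p permutes {..<n}}. history A j p = K}"
    let ?Y = "{p \<in> {p. p permutes {..<n}}. history A j p = K \<and> A j p}"
    show "real (card ?Y) \<le> h * real (card ?X)"
    proof (cases "?Y = {}")
      case False
      \<comment> \<open>A member of \<open>?Y\<close> shows that the positions indexed by
        \<open>K\<close> are compatible, as the lower bound for \<open>?X\<close> requires.\<close>
      then obtain p0 where p0: "p0 \<in> ?Y" by blast
      have "finite K" using K finite_subset by blast
      have inj': "inj_on pos {..j}" using inj j by (auto intro: inj_on_subset)
      have c: "card (pos ` K) = card K" "card (pos ` ({..<j} - K)) = j - card K"
        using K \<open>finite K\<close> inj'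
        by (subst card_image; force intro: inj_on_subset simp: card_Diff_subset)+
      have disj: "pos ` K \<inter> pos ` ({..<j} - K) = {}"
        using K inj' by (force dest: inj_onD)
      have new: "pos j \<notin> pos ` K" using K inj' by (force dest: inj_onD)
      have kj: "card K \<le> j" using card_mono[OF _ K] by simp
      define F :: real where "F = fact (n - card K - 1)"
      have red: "fact (n - card K) = real (n - card K) * F"
        unfolding F_def using kj j r by (intro fact_reduce) auto
      have p0': "p0 \<in> hits n (pos ` K)"
        using p0 by (auto simp: hits_def history_def A_def)
      have "?Y \<subseteq> hits n (insert (pos j) (pos ` K))"
        by (auto simp: hits_def history_def A_def)
      then have "card ?Y \<le> card (hits n (insert (pos j) (pos ` K)))" by (rule card_mono[rotated]) simp
      also have "\<dots> \<le> fact (n - card K - 1)"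
        using card_hits_le[of n "insert (pos j) (pos ` K)"] new \<open>finite K\<close> c by simp
      finally have "real (card ?Y) \<le> real (fact (n - card K - 1))" by (simp only: of_nat_le_iff)
      then have Y: "real (card ?Y) \<le> F" by (simp add: F_def)
      have "real (n - card K) * F - real (j - card K) * F
          \<le> real (card {p \<in> hits n (pos ` K). pos ` ({..<j} - K) \<inter> graph_of n p = {}})"
        using card_hits_avoiding_ge[OF p0' _ _ disj] \<open>finite K\<close> red c by (simp add: F_def)
      also have "\<dots> \<le> real (card ?X)"
        using K by (intro of_nat_mono card_mono)
          (auto simp: hits_def history_def A_def finite_permutations)
      finally have "real (n - j) * F \<le> real (card ?X)"
        using kj j r by (simp add: of_nat_diff algebra_simps)
      moreover have "(4 * real r) * F \<le> real (n - j) * F"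
        using j r by (intro mult_right_mono) (auto simp: F_def)
      ultimately have "(4 * real r) * real (card ?Y) \<le> real (card ?X)"
        using mult_left_mono[OF Y, of "4 * real r"] by simp
      then show ?thesis using r by (simp add: h_def field_simps)
    next
      case True
      then show ?thesis using h by (simp only: card.empty) simp
    qed
  qed (simp add: finite_permutations)
  then have 1: "(\<Sum>p | p permutes {..<n}. f (history A r p)) / fact n \<le> bern h r f"
    by (simp add: card_permutations field_simps)
  have "card {p. p permutes {..<2 * r}} * bern h r f \<le> (\<Sum>p | p permutes {..<2 * r}. f (history B r p))"
  proof (rule sum_history_ge_bern[OF _ h \<open>mono f\<close>])
    fix j K assume j: "j < r" and K: "K \<subseteq> {..<j}"
    let ?D = "\<lambda>I. (\<lambda>i::nat. (i, i)) ` I"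
    let ?X = "{p \<in> {p. p permutes {..<2 * r}}. history B j p = K}"
    let ?Y = "{p \<in> {p. p permutes {..<2 * r}}. history B j p = K \<and> B j p}"
    have "finite K" using K finite_subset by blast
    have kj: "card K \<le> j" using card_mono[OF _ K] by simp
    have D: "card (?D I) = card I" for I by (simp add: card_image inj_on_def)
    have "j \<notin> K" using K by auto
    then have cQ: "card ({..<j} - K) = j - card K" and ci: "card (insert j K) = Suc (card K)"
      using K \<open>finite K\<close> by (auto simp: card_Diff_subset)
    define G :: real where "G = fact (2 * r - card K - 2)"
    have red1: "fact (2 * r - card K - 1) = real (2 * r - card K - 1) * G"
    proof -
      have "2 * r - card K - 1 - 1 = 2 * r - card K - 2" by simp
      then show ?thesis
        unfolding G_def using kj j fact_reduce[of "2 * r - card K - 1", where 'a = real] by simp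
    qed
    have red: "fact (2 * r - card K) = real (2 * r - card K) * (real (2 * r - card K - 1) * G)"
      unfolding red1[symmetric] using kj j by (intro fact_reduce) auto
    have "?X \<subseteq> hits (2 * r) (?D K)"
      using j by (auto simp: hits_def history_def B_def mem_graph_of)
    then have "card ?X \<le> card (hits (2 * r) (?D K))" by (rule card_mono[rotated]) simp
    also have "\<dots> \<le> fact (2 * r - card K)"
      using card_hits_le[of "2 * r" "?D K"] D by simp
    finally have "real (card ?X) \<le> real (fact (2 * r - card K))" by (simp only: of_nat_le_iff)
    also have "\<dots> \<le> real (2 * r) * (real (2 * r) * G)"
      unfolding of_nat_fact red by (intro mult_mono mult_nonneg_nonneg) (auto simp: G_def)
    finally have X: "real (card ?X) \<le> 4 * real r * (real r * G)" by simp
    \<comment> \<open>Fixing \<open>insert j K\<close> and no other index below \<open>j\<close>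
      forces the history to be \<open>K\<close> and event \<open>j\<close> to occur.\<close>
    have "real (2 * r - card K - 1) * G - real (j - card K) * G
        \<le> real (card {p \<in> hits (2 * r) (?D (insert j K)). ?D ({..<j} - K) \<inter> graph_of (2 * r) p = {}})"
    proof -
      have "insert j K \<subseteq> {..<2 * r}" using j K by auto
      then have "fact (2 * r - card (?D (insert j K)))
            - real (card (?D ({..<j} - K))) * fact (2 * r - card (?D (insert j K)) - 1)
          \<le> real (card {p \<in> hits (2 * r) (?D (insert j K)). ?D ({..<j} - K) \<inter> graph_of (2 * r) p = {}})"
        using K \<open>finite K\<close> by (intro card_hits_avoiding_ge[OF id_hits]) auto
      then show ?thesis
        unfolding D cQ ci using red1 by (simp add: G_def)
    qed
    also have "\<dots> \<le> real (card ?Y)"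
    proof (intro of_nat_mono card_mono subsetI)
      fix p
      assume p: "p \<in> {p \<in> hits (2 * r) (?D (insert j K)). ?D ({..<j} - K) \<inter> graph_of (2 * r) p = {}}"
      have "p i = i \<longleftrightarrow> i \<in> K" if "i < j" for i
      proof -
        have "(i, i) \<in> graph_of (2 * r) p \<longleftrightarrow> p i = i" using that j by (simp add: mem_graph_of)
        then show ?thesis using p that by (auto simp: hits_def)
      qed
      moreover have "p j = j" "p permutes {..<2 * r}" using p by (auto simp: hits_def mem_graph_of)
      ultimately show "p \<in> ?Y" using K by (auto simp: history_def B_def)
    qed (simp add: finite_permutations)
    finally have "real (2 * r - 1 - j) * G \<le> real (card ?Y)"
      using kj j by (simp add: of_nat_diff algebra_simps)
    moreover have "real r * G \<le> real (2 * r - 1 - j) * G"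
      using j by (intro mult_right_mono) (auto simp: G_def)
    ultimately have "real r * G \<le> real (card ?Y)" by simp
    then have "4 * real r * (real r * G) \<le> 4 * real r * real (card ?Y)"
      by (intro mult_left_mono) auto
    then have "real (card ?X) \<le> 4 * real r * real (card ?Y)" using X by linarith
    then show "h * real (card ?X) \<le> real (card ?Y)"
      using r by (simp add: h_def field_simps)
  qed (simp add: finite_permutations)
  then have 2: "bern h r f \<le> (\<Sum>p | p permutes {..<2 * r}. f (history B r p)) / fact (2 * r)"
    by (simp add: card_permutations field_simps)
  show ?thesis using 1 2 unfolding sumA sumB by linarith
qed

section \<open>Second moment lower bounds\<close>

text \<open>If \<open>m\<close> positions of \<open>P\<close> are hit, \<open>3 * m - m^2\<close> is
  at most 2, and it is 0 for \<open>m = 0\<close>. Of the three means on average, the diagonal of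
  the second moment takes one, the pairs at most one because \<open>card P \<le> n\<close>, and one
  remains.\<close>

lemma card_hit_set_ge:
  assumes P: "P \<subseteq> {..<n} \<times> {..<n}" "card P \<le> n"
  shows "real (card P) * fact (n - 1)
    \<le> 2 * real (card {p. p permutes {..<n} \<and> P \<inter> graph_of n p \<noteq> {}})"
proof -
  let ?a = "\<lambda>z. of_bool (z \<in> P) :: real"
  have finP: "finite P" using P(1) finite_subset by blast
  have a: "(\<Sum>z\<in>{..<n}\<times>{..<n}. ?a z) = card P"
    using P(1) by (simp add: Int_absorb1)
  then have a2: "(\<Sum>z\<in>{..<n}\<times>{..<n}. (?a z)\<^sup>2) = card P"
    by (simp add: power2_eq_square flip: of_bool_conj)
  have S: "hit_sum n ?a p = card (P \<inter> graph_of n p)" for p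
    by (simp add: hit_sum_def Int_def conj_commute)
  have pt: "3 * hit_sum n ?a p - (hit_sum n ?a p)\<^sup>2 \<le> 2 * of_bool (P \<inter> graph_of n p \<noteq> {})" for p
  proof -
    define m where "m = card (P \<inter> graph_of n p)"
    have m: "m = 0 \<longleftrightarrow> P \<inter> graph_of n p = {}" using finP by (simp add: m_def)
    \<comment> \<open>No integer lies strictly between 1 and 2.\<close>
    have "0 \<le> (int m - 1) * (int m - 2)"
      by (cases "m = 0 \<or> m = 1") (auto intro: mult_nonneg_nonneg)
    then have "0 \<le> real_of_int ((int m - 1) * (int m - 2))" by (simp only: of_int_0_le_iff)
    then have "3 * real m - (real m)\<^sup>2 \<le> 2" by (simp add: power2_eq_square algebra_simps)
    then show ?thesis using m by (auto simp: S m_def[symmetric])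
  qed
  have "3 * (fact (n - 1) * real (card P))
      - (fact (n - 1) * real (card P) + fact (n - 2) * ((real (card P))\<^sup>2 - real (card P)))
    \<le> (\<Sum>p | p permutes {..<n}. 3 * hit_sum n ?a p - (hit_sum n ?a p)\<^sup>2)"
    using sum_hit_sum_sq[of ?a n] sum_hit_sum[of n ?a] unfolding a a2
    by (simp add: sum_subtractf sum_distrib_left[symmetric] mult.commute)
  also have "\<dots> \<le> (\<Sum>p | p permutes {..<n}. 2 * of_bool (P \<inter> graph_of n p \<noteq> {}))"
    by (rule sum_mono) (rule pt)
  also have "\<dots> = 2 * real (card {p. p permutes {..<n} \<and> P \<inter> graph_of n p \<noteq> {}})"
    by (simp add: sum_distrib_left[symmetric] finite_permutations Int_def)
  finally have *: "2 * (fact (n - 1) * real (card P)) - fact (n - 2) * ((real (card P))\<^sup>2 - real (card P))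
    \<le> 2 * real (card {p. p permutes {..<n} \<and> P \<inter> graph_of n p \<noteq> {}})"
    by (simp add: mult.commute)
  have "fact (n - 2) * ((real (card P))\<^sup>2 - real (card P)) \<le> fact (n - 1) * real (card P)"
  \<comment> \<open>For \<open>n \<le> 1\<close> the truncated \<open>n - 2\<close> breaks the
    factorial recursion, but \<open>card P\<close> is then 0 or 1 and the left side is 0.\<close>
  proof (cases "n \<le> 1")
    case True
    then have "card P = 0 \<or> card P = 1" using P(2) by linarith
    then show ?thesis by auto
  next
    case False
    then have "fact (n - 1) = real (n - 1) * fact (n - 2)"
      using fact_reduce[of "n - 1", where 'a = real] by (simp add: numeral_2_eq_2)
    moreover have "fact (n - 2) * (real (card P) * (real (card P) - 1))
        \<le> fact (n - 2) * (real (card P) * real (n - 1))"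
      using P(2) False by (intro mult_left_mono) auto
    ultimately show ?thesis
      by (simp add: power2_eq_square algebra_simps)
  qed
  with * show ?thesis by (simp add: algebra_simps)
qed

text \<open>The mean of the hit sum is \<open>m\<close>. Entries at most \<open>m\<close> make the
  diagonal of its second moment at most \<open>m^2\<close>, and the pairs contribute at most
  \<open>2 * m^2\<close> because \<open>n \<le> 2 * (n - 1)\<close>.\<close>

lemma card_hit_sum_gt_half_mean:
  fixes a :: "nat \<times> nat \<Rightarrow> real"
  assumes a: "\<And>z. 0 \<le> a z" "\<And>z. a z \<le> m" and m: "0 < m"
    and sum: "(\<Sum>z\<in>{..<n}\<times>{..<n}. a z) = n * m" and n: "2 \<le> n"
  shows "fact n \<le> 12 * real (card {p. p permutes {..<n} \<and> m / 2 < hit_sum n a p})"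
proof -
  let ?S = "hit_sum n a" and ?W = "{p. p permutes {..<n}}"
  have f1: "fact n = real n * fact (n - 1)" using n by (intro fact_reduce) auto
  have f2: "fact (n - 1) = real (n - 1) * fact (n - 2)"
    using n fact_reduce[of "n - 1", where 'a = real] by (simp add: numeral_2_eq_2)
  have E: "(\<Sum>p\<in>?W. ?S p) = fact n * m"
    unfolding sum_hit_sum sum f1 by simp
  have sq: "(\<Sum>z\<in>{..<n}\<times>{..<n}. (a z)\<^sup>2) \<le> m * (n * m)"
  proof -
    have "(\<Sum>z\<in>{..<n}\<times>{..<n}. (a z)\<^sup>2) \<le> (\<Sum>z\<in>{..<n}\<times>{..<n}. m * a z)"
      unfolding power2_eq_square using a by (intro sum_mono mult_right_mono) auto
    then show ?thesis by (simp add: sum_distrib_left[symmetric] sum)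
  qed
  have "(\<Sum>p\<in>?W. (?S p)\<^sup>2) \<le> fact (n - 1) * (\<Sum>z\<in>{..<n}\<times>{..<n}. (a z)\<^sup>2)
      + fact (n - 2) * ((n * m)\<^sup>2 - (\<Sum>z\<in>{..<n}\<times>{..<n}. (a z)\<^sup>2))"
    using sum_hit_sum_sq[of a n] a unfolding sum by simp
  also have "\<dots> \<le> fact (n - 1) * (m * (n * m)) + fact (n - 2) * (n * m)\<^sup>2"
    using sq by (intro add_mono mult_left_mono) (auto intro: sum_nonneg)
  also have "fact (n - 2) * (n * m)\<^sup>2 \<le> 2 * (real (n - 1) * fact (n - 2)) * (real n * m\<^sup>2)"
  proof -
    have "real n \<le> 2 * real (n - 1)" using n by simp
    then have "real n * (fact (n - 2) * (real n * m\<^sup>2)) \<le> 2 * real (n - 1) * (fact (n - 2) * (real n * m\<^sup>2))"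
      by (intro mult_right_mono) auto
    then show ?thesis by (simp add: power2_eq_square algebra_simps)
  qed
  finally have E2: "(\<Sum>p\<in>?W. (?S p)\<^sup>2) \<le> 3 * m\<^sup>2 * fact n"
    unfolding f2[symmetric] f1 by (simp add: power2_eq_square algebra_simps)
  \<comment> \<open>Paley--Zygmund: on the event, \<open>S \<le> S\<^sup>2 / (12 m) + 3 m\<close> by AM-GM.\<close>
  have pt: "?S p \<le> m / 2 + (?S p)\<^sup>2 / (12 * m) + 3 * m * of_bool (m / 2 < ?S p)" for p
  proof (cases "m / 2 < ?S p")
    case True
    have "0 \<le> (?S p - 6 * m)\<^sup>2 / (12 * m)" using m by simp
    also have "\<dots> = (?S p)\<^sup>2 / (12 * m) - ?S p + 3 * m"
      using m by (simp add: power2_eq_square field_simps)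
    finally show ?thesis using True m by simp
  next
    case False
    have "0 \<le> (?S p)\<^sup>2 / (12 * m)" using m by simp
    with False show ?thesis by simp
  qed
  have "fact n * m \<le> (\<Sum>p\<in>?W. m / 2 + (?S p)\<^sup>2 / (12 * m) + 3 * m * of_bool (m / 2 < ?S p))"
    unfolding E[symmetric] by (rule sum_mono) (rule pt)
  also have "\<dots> = fact n * (m / 2) + (\<Sum>p\<in>?W. (?S p)\<^sup>2) / (12 * m)
      + 3 * m * real (card {p. p permutes {..<n} \<and> m / 2 < ?S p})"
    by (simp add: sum.distrib sum_divide_distrib[symmetric] sum_distrib_left[symmetric]
        card_permutations finite_permutations Int_def)
  also have "\<dots> \<le> fact n * (m / 2) + (3 * m\<^sup>2 * fact n) / (12 * m)
      + 3 * m * real (card {p. p permutes {..<n} \<and> m / 2 < ?S p})"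
    using E2 m by (intro add_mono divide_right_mono) auto
  also have "(3 * m\<^sup>2 * fact n) / (12 * m) = fact n * (m / 4)"
    using m by (simp add: power2_eq_square field_simps)
  finally have "m * fact n \<le> m * (12 * real (card {p. p permutes {..<n} \<and> m / 2 < ?S p}))"
    by (simp add: algebra_simps)
  then show ?thesis using m by (simp only: mult_le_cancel_left_pos)
qed

subsection \<open>Step functions in rearrangement invariant spaces\<close>

definition distr :: "(real \<Rightarrow> real) \<Rightarrow> real \<Rightarrow> real" where
  "distr f v = measure I01 {u \<in> {0..1}. v < \<bar>f u\<bar>}"

text \<open>The index set is arbitrary, to cover \<open>U_op\<close> (ranks), \<open>T_op\<close>
  (permutations) and subdivided cells (pairs) alike.\<close>

definition step :: "'a set \<Rightarrow> ('a \<Rightarrow> real set) \<Rightarrow> ('a \<Rightarrow> real) \<Rightarrow> real \<Rightarrow> real" where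
  "step A I w t = (\<Sum>a\<in>A. w a * indicator (I a) t)"

text \<open>Cells are numbered from 1, like the values of the enumeration \<open>l\<close>.\<close>

definition cell :: "real \<Rightarrow> nat \<Rightarrow> real set" where
  "cell M i = {(real i - 1) / M ..< real i / M}"

text \<open>Boundedness ensures that the infimum defining \<open>decr_rearr\<close> is over a
  nonempty set.\<close>

definition bdd_meas :: "(real \<Rightarrow> real) \<Rightarrow> bool" where
  "bdd_meas f \<longleftrightarrow> f \<in> borel_measurable I01 \<and> (\<exists>B. \<forall>u. \<bar>f u\<bar> \<le> B)"

lemma sets_I01: "S \<in> sets I01 \<longleftrightarrow> S \<in> sets lebesgue \<and> S \<subseteq> {0..1}"
  by (auto simp: sets_restrict_space_iff)

lemma finite_measure_I01: "finite_measure I01"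
  by (rule finite_measure_lebesgue_on) simp

lemma measure_I01: "S \<in> sets lebesgue \<Longrightarrow> S \<subseteq> {0..1} \<Longrightarrow> measure I01 S = measure lebesgue S"
  by (subst measure_restrict_space) auto

lemma bdd_meas_step:
  assumes "finite A" "\<And>a. a \<in> A \<Longrightarrow> I a \<in> sets lebesgue \<and> I a \<subseteq> {0..1}"
  shows "bdd_meas (step A I w)"
  unfolding bdd_meas_def
proof (intro conjI exI allI)
  show "step A I w \<in> borel_measurable I01"
    unfolding step_def using assms(2)
    by (intro borel_measurable_sum borel_measurable_times borel_measurable_const
        borel_measurable_indicator) (auto simp: sets_I01)
  fix u
  have "\<bar>step A I w u\<bar> \<le> (\<Sum>a\<in>A. \<bar>w a * indicator (I a) u\<bar>)"
    unfolding step_def by (rule sum_abs)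
  also have "\<dots> \<le> (\<Sum>a\<in>A. \<bar>w a\<bar>)"
    by (rule sum_mono) (auto simp: indicator_def)
  finally show "\<bar>step A I w u\<bar> \<le> (\<Sum>a\<in>A. \<bar>w a\<bar>)" .
qed

text \<open>Points outside all cells have value 0, and \<open>0 \<le> v\<close> keeps them from
  being counted.\<close>

lemma distr_step:
  assumes "finite A" and disj: "disjoint_family_on I A"
    and I: "\<And>a. a \<in> A \<Longrightarrow> I a \<in> sets lebesgue \<and> I a \<subseteq> {0..1} \<and> measure lebesgue (I a) = h"
    and w: "\<And>a. a \<in> A \<Longrightarrow> 0 \<le> w a" and "0 \<le> v"
  shows "distr (step A I w) v = h * card {a \<in> A. v < w a}"
proof -
  interpret finite_measure I01 by (rule finite_measure_I01)
  let ?B = "{a \<in> A. v < w a}"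
  have eq: "step A I w u = w a" if "a \<in> A" "u \<in> I a" for a u
  proof -
    have "step A I w u = (\<Sum>b\<in>A. if b = a then w a else 0)"
      unfolding step_def
    proof (rule sum.cong[OF refl])
      fix b assume "b \<in> A"
      then show "w b * indicator (I b) u = (if b = a then w a else 0)"
        using disj that by (auto simp: disjoint_family_on_def indicator_def)
    qed
    then show ?thesis using that assms(1) by simp
  qed
  have "{u \<in> {0..1}. v < \<bar>step A I w u\<bar>} = (\<Union>a\<in>?B. I a)"
  proof (intro equalityI subsetI)
    fix u assume u: "u \<in> {u \<in> {0..1}. v < \<bar>step A I w u\<bar>}"
    have "\<exists>a\<in>A. u \<in> I a"
    proof (rule ccontr)
      assume "\<not> ?thesis"
      then have "step A I w u = 0" by (simp add: step_def)
      with u \<open>0 \<le> v\<close> show False by simp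
    qed
    then obtain a where a: "a \<in> A" "u \<in> I a" by blast
    then have "v < w a" using u eq[OF a] w[OF a(1)] by simp
    with a show "u \<in> (\<Union>a\<in>?B. I a)" by blast
  next
    fix u assume "u \<in> (\<Union>a\<in>?B. I a)"
    then obtain a where a: "a \<in> A" "v < w a" "u \<in> I a" by blast
    then show "u \<in> {u \<in> {0..1}. v < \<bar>step A I w u\<bar>}"
      using eq[OF a(1,3)] I[OF a(1)] \<open>0 \<le> v\<close> by auto
  qed
  then have "distr (step A I w) v = measure I01 (\<Union>a\<in>?B. I a)" by (simp add: distr_def)
  also have "\<dots> = (\<Sum>a\<in>?B. measure I01 (I a))"
    using assms(1) I disj
    by (intro finite_measure_finite_Union)
      (auto simp: sets_I01 disjoint_family_on_def)
  also have "\<dots> = (\<Sum>a\<in>?B. h)"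
    using I by (intro sum.cong refl) (auto simp: measure_I01)
  finally show ?thesis by simp
qed

lemma distr_const:
  assumes "0 \<le> v" "0 \<le> c"
  shows "distr (\<lambda>_. c) v = (if v < c then 1 else 0)"
proof -
  have "{u \<in> {0..1}. v < \<bar>c\<bar>} = (if v < c then {0..1::real} else {})" using assms by auto
  then show ?thesis by (simp add: distr_def measure_I01)
qed

lemma disjoint_cells:
  assumes "0 < M" "inj_on e A"
  shows "disjoint_family_on (\<lambda>a. cell M (e a)) A"
proof -
  have "i \<le> j" if "t \<in> cell M i" "t \<in> cell M j" for t i j
  proof -
    have "real i - 1 \<le> t * M" "t * M < real j"
      using that assms(1) by (auto simp: cell_def field_simps)
    then have "real i < real (j + 1)" by simp
    then show ?thesis by (simp only: of_nat_less_iff)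
  qed
  then have "i = j" if "t \<in> cell M i" "t \<in> cell M j" for t i j
    using that by (meson antisym)
  then show ?thesis
    using assms(2) unfolding disjoint_family_on_def inj_on_def by blast
qed

lemma cell_props:
  assumes "0 < M" "1 \<le> i" "real i \<le> M"
  shows "cell M i \<in> sets lebesgue \<and> cell M i \<subseteq> {0..1} \<and> measure lebesgue (cell M i) = 1 / M"
proof -
  have "0 \<le> (real i - 1) / M" "real i / M \<le> 1" "(real i - 1) / M \<le> real i / M"
    using assms by (auto simp: divide_right_mono)
  then show ?thesis by (auto simp: cell_def diff_divide_distrib[symmetric])
qed

lemma bdd_meas_step_cell:
  assumes "finite A" "0 < M" "\<And>a. a \<in> A \<Longrightarrow> 1 \<le> e a \<and> real (e a) \<le> M"
  shows "bdd_meas (step A (\<lambda>a. cell M (e a)) w)"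
  using assms cell_props by (intro bdd_meas_step) auto

lemma distr_step_cell:
  assumes "finite A" "0 < M" "inj_on e A" "\<And>a. a \<in> A \<Longrightarrow> 1 \<le> e a \<and> real (e a) \<le> M"
    "\<And>a. a \<in> A \<Longrightarrow> 0 \<le> w a" "0 \<le> v"
  shows "distr (step A (\<lambda>a. cell M (e a)) w) v = card {a \<in> A. v < w a} / M"
  using assms disjoint_cells cell_props
  by (subst distr_step[where h = "1 / M"]) auto

lemma bdd_meas_const [simp]: "bdd_meas (\<lambda>_. c)"
  by (auto simp: bdd_meas_def)

lemma bdd_meas_sum: "(\<And>s. s \<in> S \<Longrightarrow> bdd_meas (F s)) \<Longrightarrow> bdd_meas (\<lambda>t. \<Sum>s\<in>S. F s t)"
proof -
  assume F: "\<And>s. s \<in> S \<Longrightarrow> bdd_meas (F s)"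
  then have "\<forall>s\<in>S. \<exists>B. \<forall>u. \<bar>F s u\<bar> \<le> B" by (auto simp: bdd_meas_def)
  then obtain B where B: "\<forall>s\<in>S. \<forall>u. \<bar>F s u\<bar> \<le> B s" by metis
  show ?thesis
    unfolding bdd_meas_def
  proof (intro conjI exI allI)
    show "(\<lambda>t. \<Sum>s\<in>S. F s t) \<in> borel_measurable I01"
      using F by (intro borel_measurable_sum) (auto simp: bdd_meas_def)
    fix u show "\<bar>\<Sum>s\<in>S. F s u\<bar> \<le> (\<Sum>s\<in>S. B s)"
      using B by (intro order_trans[OF sum_abs] sum_mono) auto
  qed
qed

text \<open>A smaller distribution function enlarges the set under the infimum; the bound on
  \<open>g\<close> makes the set for \<open>g\<close> nonempty.\<close>

lemma decr_rearr_mono: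
  assumes "bdd_meas g" "\<And>v. 0 \<le> v \<Longrightarrow> distr f v \<le> distr g v" "0 \<le> t"
  shows "decr_rearr f t \<le> decr_rearr g t"
  unfolding decr_rearr_def
proof (rule cInf_superset_mono)
  obtain B where B: "\<And>u. \<bar>g u\<bar> \<le> B" using assms(1) by (auto simp: bdd_meas_def)
  have "0 \<le> B" using B[of 0] by simp
  moreover have "{u \<in> {0..1}. B < \<bar>g u\<bar>} = {}" using B by (auto simp: not_less)
  then have "measure I01 {u \<in> {0..1}. B < \<bar>g u\<bar>} \<le> t"
    using \<open>0 \<le> t\<close> by (simp only: measure_empty)
  ultimately show "{s. 0 \<le> s \<and> measure I01 {u \<in> {0..1}. s < \<bar>g u\<bar>} \<le> t} \<noteq> {}"
    by blast
  show "bdd_below {s. 0 \<le> s \<and> measure I01 {u \<in> {0..1}. s < \<bar>f u\<bar>} \<le> t}"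
    by (rule bdd_belowI[of _ 0]) auto
  show "{s. 0 \<le> s \<and> measure I01 {u \<in> {0..1}. s < \<bar>g u\<bar>} \<le> t}
      \<subseteq> {s. 0 \<le> s \<and> measure I01 {u \<in> {0..1}. s < \<bar>f u\<bar>} \<le> t}"
    using assms(2) by (auto simp: distr_def intro: order_trans)
qed

section \<open>Norm comparison through distribution functions\<close>

locale unital_ri_space = ri_space +
  assumes one_mem: "(\<lambda>_. 1) \<in> E" and norm_one: "N (\<lambda>_. 1) = 1"
begin

lemma norm_const: "N (\<lambda>_. c) = \<bar>c\<bar>"
  using norm_scale[OF one_mem, of c] norm_one by simp

lemma const_mem: "(\<lambda>_. c) \<in> E"
  using scale_mem[OF one_mem, of c] by simp

text \<open>A bounded function lies below a constant in distribution, and constants are multiples of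
  the unit function.\<close>

lemma bdd_meas_mem:
  assumes "bdd_meas f"
  shows "f \<in> E"
proof -
  obtain B where B: "\<And>u. \<bar>f u\<bar> \<le> B" using assms by (auto simp: bdd_meas_def)
  have "0 \<le> B" using B[of 0] by simp
  have "distr f v \<le> distr (\<lambda>_. B) v" if "0 \<le> v" for v
  proof (cases "v < B")
    case True
    interpret finite_measure I01 by (rule finite_measure_I01)
    have "distr f v \<le> measure I01 (space I01)"
      unfolding distr_def by (rule bounded_measure)
    also have "\<dots> = 1" by (simp add: measure_I01)
    finally show ?thesis using True that \<open>0 \<le> B\<close> by (simp add: distr_const)
  next
    case False
    then have "\<not> v < \<bar>f u\<bar>" for u using B[of u] by linarith
    then show ?thesis using False that \<open>0 \<le> B\<close> by (simp add: distr_const distr_def)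
  qed
  then have "\<forall>t\<in>{0<..1}. decr_rearr f t \<le> decr_rearr (\<lambda>_. B) t"
    by (intro ballI decr_rearr_mono) auto
  then show ?thesis
    using assms by (intro rearr_mem[OF const_mem[of B]]) (auto simp: bdd_meas_def)
qed

lemma norm_le_of_distr:
  assumes "bdd_meas f" "bdd_meas g" "\<And>v. 0 \<le> v \<Longrightarrow> distr f v \<le> distr g v"
  shows "N f \<le> N g"
  using assms by (intro rearr_norm_le bdd_meas_mem ballI decr_rearr_mono) (auto simp: bdd_meas_def)

lemma norm_sum_le:
  assumes "finite S" "\<And>s. s \<in> S \<Longrightarrow> F s \<in> E"
  shows "(\<lambda>t. \<Sum>s\<in>S. F s t) \<in> E \<and> N (\<lambda>t. \<Sum>s\<in>S. F s t) \<le> (\<Sum>s\<in>S. N (F s))"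
  using assms
proof (induction S rule: finite_induct)
  case empty
  then show ?case using zero_mem norm_const[of 0] by simp
next
  case (insert s S)
  then have "F s \<in> E" "(\<lambda>t. \<Sum>s\<in>S. F s t) \<in> E" "N (\<lambda>t. \<Sum>s\<in>S. F s t) \<le> (\<Sum>s\<in>S. N (F s))"
    by auto
  then show ?case
    using insert.hyps add_mem norm_triangle[of "F s" "\<lambda>t. \<Sum>s\<in>S. F s t"] by simp
qed

text \<open>Cutting each of \<open>n\<close> cells into \<open>M\<close> pieces splits a step function into \<open>M\<close>
  functions, each of which is dominated by \<open>g\<close>.\<close>

lemma norm_dilation_le:
  assumes f: "bdd_meas f" and g: "bdd_meas g" and n: "1 \<le> n" and M: "1 \<le> M"
    and w: "\<And>k. k \<in> {1..n} \<Longrightarrow> 0 \<le> w k"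
    and fw: "\<And>v. 0 \<le> v \<Longrightarrow> distr f v \<le> card {k \<in> {1..n}. v < w k} / n"
    and wg: "\<And>v. 0 \<le> v \<Longrightarrow> card {k \<in> {1..n}. v < w k} / (real M * real n) \<le> distr g v"
  shows "N f \<le> M * N g"
proof -
  \<comment> \<open>Consecutive numbering, from 1, of piece \<open>s\<close> of cell
    \<open>k\<close>; quotient and remainder by \<open>M\<close> recover \<open>k - 1\<close> and
    \<open>s\<close>.\<close>
  define e where "e k s = M * (k - 1) + s + 1" for k s :: nat
  define piece where "piece s = step {1..n} (\<lambda>k. cell (real M * real n) (e k s)) w" for s
  have e_le: "1 \<le> e k s \<and> real (e k s) \<le> real M * real n" if "k \<in> {1..n}" "s < M" for k s
  proof -
    have "M * (k - 1) + s + 1 \<le> M * (k - 1) + M" using that by simp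
    also have "\<dots> = M * k" using that by (cases k) auto
    also have "\<dots> \<le> M * n" using that by simp
    finally have "real (e k s) \<le> real (M * n)" unfolding e_def by (simp only: of_nat_le_iff)
    then show ?thesis by (simp add: e_def)
  qed
  have e_inj: "k = k' \<and> s = s'" if "e k s = e k' s'" "s < M" "s' < M" "k \<in> {1..n}" "k' \<in> {1..n}"
    for k k' s s'
  proof -
    have "M * (k - 1) + s = M * (k' - 1) + s'" using that(1) by (simp add: e_def)
    then have "(M * (k - 1) + s) div M = (M * (k' - 1) + s') div M"
      "(M * (k - 1) + s) mod M = (M * (k' - 1) + s') mod M" by simp_all
    then have "k - 1 = k' - 1" "s = s'" using that M by simp_all
    then show ?thesis using that(4,5) unfolding atLeastAtMost_iff by linarith
  qed
  have Mn: "0 < real M * real n" using n M by simp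
  have piece: "bdd_meas (piece s)" "N (piece s) \<le> N g" if "s < M" for s
  proof -
    show *: "bdd_meas (piece s)"
      unfolding piece_def using e_le[OF _ that] Mn by (intro bdd_meas_step_cell) auto
    have "distr (piece s) v = card {k \<in> {1..n}. v < w k} / (real M * real n)" if "0 \<le> v" for v
      unfolding piece_def using e_le[OF _ \<open>s < M\<close>] Mn e_inj[OF _ \<open>s < M\<close> \<open>s < M\<close>] w that
      by (intro distr_step_cell) (auto simp: inj_on_def)
    then show "N (piece s) \<le> N g"
      using wg by (intro norm_le_of_distr * g) auto
  qed
  have sum_eq: "(\<lambda>t. \<Sum>s<M. piece s t)
      = step ({1..n} \<times> {..<M}) (\<lambda>z. cell (real M * real n) (case z of (k, s) \<Rightarrow> e k s)) (\<lambda>z. w (fst z))"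
    unfolding piece_def step_def
    by (rule ext, subst sum.swap) (simp only: sum.cartesian_product case_prod_unfold)
  \<comment> \<open>Together the pieces give each \<open>w k\<close> a set of measure
    \<open>1 / n\<close> again, which suffices to dominate \<open>f\<close>.\<close>
  have "N f \<le> N (\<lambda>t. \<Sum>s<M. piece s t)"
  proof (rule norm_le_of_distr[OF f])
    show "bdd_meas (\<lambda>t. \<Sum>s<M. piece s t)" using piece by (intro bdd_meas_sum) auto
    fix v :: real assume v: "0 \<le> v"
    have "{z \<in> {1..n} \<times> {..<M}. v < w (fst z)} = {k \<in> {1..n}. v < w k} \<times> {..<M}" by auto
    then have "distr (\<lambda>t. \<Sum>s<M. piece s t) v
        = card ({k \<in> {1..n}. v < w k} \<times> {..<M}) / (real M * real n)"
      unfolding sum_eq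
    proof (subst distr_step_cell)
      show "inj_on (\<lambda>z. case z of (k, s) \<Rightarrow> e k s) ({1..n} \<times> {..<M})"
      proof (rule inj_onI)
        fix z z' assume "z \<in> {1..n} \<times> {..<M}" "z' \<in> {1..n} \<times> {..<M}"
          "(case z of (k, s) \<Rightarrow> e k s) = (case z' of (k, s) \<Rightarrow> e k s)"
        then show "z = z'"
          using e_inj[of "fst z" "snd z" "fst z'" "snd z'"] by (simp add: case_prod_unfold prod_eq_iff mem_Times_iff)
      qed
    qed (use e_le Mn w v in \<open>auto simp del: atLeastAtMost_iff\<close>)
    also have "\<dots> = card {k \<in> {1..n}. v < w k} / n"
      using M by (simp add: card_cartesian_product)
    finally show "distr f v \<le> distr (\<lambda>t. \<Sum>s<M. piece s t) v" using fw[OF v] by simp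
  qed
  also have "\<dots> \<le> (\<Sum>s<M. N (piece s))"
    using norm_sum_le[of "{..<M}" piece] piece bdd_meas_mem by auto
  also have "\<dots> \<le> (\<Sum>s<M. N g)" using piece by (intro sum_mono) auto
  finally show ?thesis by simp
qed

end

section \<open>Decreasing rearrangement of matrix entries\<close>

text \<open>\<open>mat_rearr\<close> lists values only. Sorting the positions by absolute value and
  reversing yields the same values together with a numbering \<open>s\<close> of positions, needed
  to cut the matrix into blocks.\<close>

lemma mat_rearr_enumeration:
  assumes x: "x \<in> carrier_mat n n"
  obtains s where "bij_betw s {1..n\<^sup>2} ({..<n} \<times> {..<n})"
    and "\<And>k. k \<in> {1..n\<^sup>2} \<Longrightarrow> \<bar>x $$ s k\<bar> = mat_rearr x k"
    and "\<And>j k. 1 \<le> j \<Longrightarrow> j \<le> k \<Longrightarrow> k \<le> n\<^sup>2 \<Longrightarrow> mat_rearr x k \<le> mat_rearr x j"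
proof -
  define f where "f z = \<bar>x $$ z\<bar>" for z
  define ps where "ps = List.product [0..<n] [0..<n]"
  define qs where "qs = rev (sort_key f ps)"
  define s where "s k = qs ! (k - 1)" for k
  have list: "[\<bar>x $$ (i, j)\<bar>. i \<leftarrow> [0..<dim_row x], j \<leftarrow> [0..<dim_col x]] = map f ps"
    using x by (simp add: ps_def f_def product_concat_map map_concat o_def)
  have "sort (map f ps) = map f (sort_key f ps)"
    by (rule properties_for_sort) (auto simp: mset_map)
  then have rearr: "mat_rearr x k = map f qs ! (k - 1)" for k
    unfolding mat_rearr_def list qs_def by (simp add: rev_map)
  have len: "length qs = n\<^sup>2" by (simp add: qs_def ps_def power2_eq_square)
  have set: "set qs = {..<n} \<times> {..<n}" by (auto simp: qs_def ps_def)
  have dist: "distinct qs" by (simp add: qs_def ps_def distinct_product)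
  have "bij_betw s {1..n\<^sup>2} ({..<n} \<times> {..<n})"
  proof -
    have "bij_betw (\<lambda>k. k - 1) {1..n\<^sup>2} {..<length qs}"
      unfolding len by (rule bij_betw_byWitness[where f' = Suc]) auto
    moreover have "bij_betw ((!) qs) {..<length qs} ({..<n} \<times> {..<n})"
      using dist set by (intro bij_betw_nth) auto
    ultimately have "bij_betw ((!) qs \<circ> (\<lambda>k. k - 1)) {1..n\<^sup>2} ({..<n} \<times> {..<n})"
      by (rule bij_betw_trans)
    then show ?thesis by (simp add: s_def[abs_def] o_def)
  qed
  moreover have "\<bar>x $$ s k\<bar> = mat_rearr x k" if "k \<in> {1..n\<^sup>2}" for k
  proof -
    have "k - 1 < length qs" using that len by auto
    then show ?thesis by (simp add: rearr s_def f_def)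
  qed
  moreover have "mat_rearr x k \<le> mat_rearr x j" if "1 \<le> j" "j \<le> k" "k \<le> n\<^sup>2" for j k
  proof -
    have "sorted (map f (sort_key f ps))" by simp
    moreover have "map f (sort_key f ps) = rev (map f qs)" by (simp add: qs_def rev_map)
    ultimately have "sorted (rev (map f qs))" by simp
    then have "map f qs ! (k - 1) \<le> map f qs ! (j - 1)"
      using that len by (intro sorted_rev_nth_mono) auto
    then show ?thesis by (simp add: rearr)
  qed
  ultimately show ?thesis using that by blast
qed

lemma card_mat_rearr:
  assumes x: "x \<in> carrier_mat n n"
  shows "card {k \<in> {1..n\<^sup>2}. v < mat_rearr x k} = card {z \<in> {..<n} \<times> {..<n}. v < \<bar>x $$ z\<bar>}"
proof -
  obtain s where s: "bij_betw s {1..n\<^sup>2} ({..<n} \<times> {..<n})"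
    and eq: "\<And>k. k \<in> {1..n\<^sup>2} \<Longrightarrow> \<bar>x $$ s k\<bar> = mat_rearr x k"
    using mat_rearr_enumeration[OF x] by metis
  have "s ` {k \<in> {1..n\<^sup>2}. v < mat_rearr x k} = {z \<in> s ` {1..n\<^sup>2}. v < \<bar>x $$ z\<bar>}"
    using eq by auto
  then have "bij_betw s {k \<in> {1..n\<^sup>2}. v < mat_rearr x k} {z \<in> {..<n} \<times> {..<n}. v < \<bar>x $$ z\<bar>}"
    using s by (intro bij_betw_subset[OF s]) (simp_all only: bij_betw_def, blast)
  then show ?thesis by (rule bij_betw_same_card)
qed

lemma mat_rearr_nonneg:
  assumes "x \<in> carrier_mat n n" "k \<in> {1..n\<^sup>2}"
  shows "0 \<le> mat_rearr x k"
  using mat_rearr_enumeration[OF assms(1)] assms(2) by (metis abs_ge_zero)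

lemma U_op_eq_step:
  assumes "x \<in> carrier_mat n n"
  shows "U_op x = step {1..n} (\<lambda>k. {(real k - 1) / real n <..< real k / real n}) (mat_rearr x)"
  using assms by (auto simp: U_op_def step_def Let_def)

lemma U_interval_props:
  assumes "k \<in> {1..n}"
  shows "{(real k - 1) / real n <..< real k / real n} \<in> sets lebesgue \<and>
    {(real k - 1) / real n <..< real k / real n} \<subseteq> {0..1} \<and>
    measure lebesgue {(real k - 1) / real n <..< real k / real n} = 1 / real n"
proof -
  have "0 \<le> (real k - 1) / real n" "real k / real n \<le> 1" "(real k - 1) / real n \<le> real k / real n"
    using assms by (auto simp: divide_right_mono)
  then show ?thesis by (auto simp: diff_divide_distrib[symmetric])
qed

lemma bdd_meas_U_op:
  assumes "x \<in> carrier_mat n n"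
  shows "bdd_meas (U_op x)"
  unfolding U_op_eq_step[OF assms] using U_interval_props by (intro bdd_meas_step) blast+

lemma distr_U_op:
  assumes x: "x \<in> carrier_mat n n" and "0 \<le> v"
  shows "distr (U_op x) v = card {k \<in> {1..n}. v < mat_rearr x k} / n"
proof -
  have "0 \<le> mat_rearr x k" if "k \<in> {1..n}" for k
  proof -
    have "n \<le> n\<^sup>2" by (simp add: power2_nat_le_imp_le power2_eq_square)
    then show ?thesis using that by (intro mat_rearr_nonneg[OF x]) auto
  qed
  moreover have "disjoint_family_on (\<lambda>k. {(real k - 1) / real n <..< real k / real n}) {1..n}"
  proof (cases "n = 0")
    case False
    \<comment> \<open>The open intervals of \<open>U_op\<close> inherit disjointness from the
      half-open cells containing them.\<close>
    have "disjoint_family_on (\<lambda>k. cell n (id k)) {1..n}"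
      using False by (intro disjoint_cells) auto
    moreover have "{(real k - 1) / real n <..< real k / real n} \<subseteq> cell n k" for k
      by (auto simp: cell_def)
    ultimately show ?thesis
      unfolding disjoint_family_on_def by fastforce
  qed (simp add: disjoint_family_on_def)
  ultimately show ?thesis
    unfolding U_op_eq_step[OF x] using U_interval_props \<open>0 \<le> v\<close>
    by (subst distr_step[where h = "1 / n"]) auto
qed

subsection \<open>Functions of a random permutation\<close>

text \<open>After division by \<open>a + b\<close> both terms lie in the unit interval, where an
  exponent at most 1 only increases them.\<close>

lemma powr_add_le:
  fixes a b r :: real
  assumes "0 \<le> a" "0 \<le> b" "0 < r" "r \<le> 1"
  shows "(a + b) powr r \<le> a powr r + b powr r"
proof (cases "a + b = 0")
  case False
  then have pos: "0 < a + b" using assms by linarith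
  have "a / (a + b) \<le> (a / (a + b)) powr r" "b / (a + b) \<le> (b / (a + b)) powr r"
    using assms pos powr_mono'[of r 1 "a / (a + b)"] powr_mono'[of r 1 "b / (a + b)"] by auto
  then have "1 \<le> (a / (a + b)) powr r + (b / (a + b)) powr r"
    using pos add_divide_distrib[of a b "a + b"] by simp
  also have "\<dots> = (a powr r + b powr r) / (a + b) powr r"
    using assms pos by (simp add: powr_divide add_divide_distrib)
  finally show ?thesis using pos by (simp add: field_simps)
qed (use assms in auto)

lemma powr_sum_le:
  fixes f :: "'a \<Rightarrow> real"
  assumes "finite S" "\<And>s. s \<in> S \<Longrightarrow> 0 \<le> f s" "0 < r" "r \<le> 1"
  shows "(\<Sum>s\<in>S. f s) powr r \<le> (\<Sum>s\<in>S. f s powr r)"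
  using assms(1,2)
proof (induction S rule: finite_induct)
  case (insert s S)
  have "(\<Sum>s\<in>insert s S. f s) powr r \<le> f s powr r + (\<Sum>s\<in>S. f s) powr r"
    using insert assms(3,4) by (auto intro!: powr_add_le sum_nonneg)
  also have "\<dots> \<le> (\<Sum>s\<in>insert s S. f s powr r)" using insert by simp
  finally show ?case .
qed simp

definition restr :: "('a \<Rightarrow> real) \<Rightarrow> 'a set \<Rightarrow> 'a \<Rightarrow> real" where
  "restr a B z = (if z \<in> B then a z else 0)"

lemma hit_sum_nonneg: "(\<And>z. 0 \<le> a z) \<Longrightarrow> 0 \<le> hit_sum n a p"
  by (simp add: hit_sum_def sum_nonneg)

lemma hit_sum_mono: "(\<And>z. a z \<le> b z) \<Longrightarrow> hit_sum n a p \<le> hit_sum n b p"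
  by (simp add: hit_sum_def sum_mono)

lemma sum_restr_image:
  assumes "inj_on s B" "s ` B \<subseteq> P" "finite P"
  shows "(\<Sum>z\<in>P. restr a (s ` B) z) = (\<Sum>k\<in>B. a (s k))"
proof -
  have "(\<Sum>z\<in>P. restr a (s ` B) z) = (\<Sum>z\<in>s ` B. a z)"
    using assms by (intro sum.mono_neutral_cong_right) (auto simp: restr_def)
  then show ?thesis using assms(1) by (simp add: sum.reindex)
qed

lemma hit_sum_restr_image:
  assumes "inj_on s B" "finite B"
  shows "hit_sum n (restr a (s ` B)) p = (\<Sum>k | k \<in> B \<and> s k \<in> graph_of n p. a (s k))"
proof -
  have "hit_sum n (restr a (s ` B)) p = (\<Sum>z\<in>s ` {k \<in> B. s k \<in> graph_of n p}. a z)"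
    unfolding hit_sum_def using assms by (intro sum.mono_neutral_cong_right) (auto simp: restr_def)
  also have "\<dots> = (\<Sum>k | k \<in> B \<and> s k \<in> graph_of n p. a (s k))"
    using assms(1) by (subst sum.reindex) (auto simp: inj_on_def)
  finally show ?thesis .
qed

locale perm_ri_space = unital_ri_space +
  fixes l :: "nat \<Rightarrow> (nat \<Rightarrow> nat) \<Rightarrow> nat" and q :: real
  assumes q: "1 \<le> q"
    and enum: "\<And>n. n \<ge> 1 \<Longrightarrow> bij_betw (l n) {p. p permutes {..<n}} {1..fact n}"
begin

text \<open>Realises a function of a uniformly random permutation on the unit interval; its
  distribution does not depend on \<open>l\<close>.\<close>

definition rv :: "nat \<Rightarrow> ((nat \<Rightarrow> nat) \<Rightarrow> real) \<Rightarrow> real \<Rightarrow> real" where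
  "rv n = step {p. p permutes {..<n}} (\<lambda>p. cell (fact n) (l n p))"

text \<open>The argument \<open>a\<close> already holds the \<open>q\<close>-th powers of the
  entries, so only the outer root appears.\<close>

definition Tq :: "nat \<Rightarrow> (nat \<times> nat \<Rightarrow> real) \<Rightarrow> real \<Rightarrow> real" where
  "Tq n a = rv n (\<lambda>p. hit_sum n a p powr (1 / q))"

lemma enum_bounds:
  assumes "1 \<le> n" "p permutes {..<n}"
  shows "1 \<le> l n p \<and> real (l n p) \<le> fact n"
proof -
  have "l n p \<in> {1..fact n}"
    using enum[OF assms(1)] assms(2) by (auto dest: bij_betwE)
  then have "1 \<le> l n p" "l n p \<le> fact n" by auto
  from this(2) have "real (l n p) \<le> real (fact n)" by (simp only: of_nat_le_iff)
  then show ?thesis using \<open>1 \<le> l n p\<close> by simp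
qed

lemma bdd_meas_rv: "1 \<le> n \<Longrightarrow> bdd_meas (rv n w)"
  unfolding rv_def using enum_bounds
  by (intro bdd_meas_step_cell) (auto simp: finite_permutations)

lemma distr_rv:
  assumes "1 \<le> n" "\<And>p. 0 \<le> w p" "0 \<le> v"
  shows "distr (rv n w) v = card {p. p permutes {..<n} \<and> v < w p} / fact n"
  unfolding rv_def using enum_bounds assms enum[OF assms(1)]
  by (subst distr_step_cell) (auto simp: finite_permutations bij_betw_def)

lemma norm_rv_le:
  assumes "1 \<le> m" "1 \<le> n" "\<And>p. 0 \<le> w p" "\<And>p. 0 \<le> w' p"
    and "\<And>v. 0 \<le> v \<Longrightarrow> real (card {p. p permutes {..<m} \<and> v < w p}) / fact m
      \<le> real (card {p. p permutes {..<n} \<and> v < w' p}) / fact n"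
  shows "N (rv m w) \<le> N (rv n w')"
  using assms by (intro norm_le_of_distr bdd_meas_rv) (auto simp: distr_rv)

lemma norm_rv_mono:
  assumes "1 \<le> n" "\<And>p. 0 \<le> w p" "\<And>p. w p \<le> w' p"
  shows "N (rv n w) \<le> N (rv n w')"
proof (rule norm_rv_le[OF assms(1,1)])
  show "0 \<le> w p" "0 \<le> w' p" for p using assms(2,3)[of p] by auto
  show "real (card {p. p permutes {..<n} \<and> v < w p}) / fact n
      \<le> real (card {p. p permutes {..<n} \<and> v < w' p}) / fact n" for v
    using assms(3)
    by (intro divide_right_mono of_nat_mono card_mono) (auto simp: finite_permutations intro: less_le_trans)
qed

lemma norm_rv_sum_le:
  assumes "1 \<le> n" "finite S"
  shows "N (rv n (\<lambda>p. \<Sum>s\<in>S. w s p)) \<le> (\<Sum>s\<in>S. N (rv n (w s)))"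
proof -
  have "rv n (\<lambda>p. \<Sum>s\<in>S. w s p) = (\<lambda>t. \<Sum>s\<in>S. rv n (w s) t)"
    unfolding rv_def step_def by (rule ext, subst sum.swap) (simp only: sum_distrib_right)
  then show ?thesis
    using norm_sum_le[OF assms(2), of "\<lambda>s. rv n (w s)"] bdd_meas_rv[OF assms(1)] bdd_meas_mem by simp
qed

lemma norm_rv_scale:
  assumes "1 \<le> n"
  shows "N (rv n (\<lambda>p. c * w p)) = \<bar>c\<bar> * N (rv n w)"
proof -
  have "rv n (\<lambda>p. c * w p) = (\<lambda>t. c * rv n w t)"
    unfolding rv_def step_def by (simp add: sum_distrib_left mult.assoc)
  then show ?thesis
    using norm_scale bdd_meas_mem[OF bdd_meas_rv[OF assms]] by simp
qed

lemma norm_rv_one_le: "1 \<le> n \<Longrightarrow> N (rv n (\<lambda>_. 1)) \<le> 1"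
  using norm_le_of_distr[of "rv n (\<lambda>_. 1)" "\<lambda>_. 1"]
  by (auto simp: norm_one bdd_meas_rv distr_rv distr_const card_permutations)

lemma less_powr_iff:
  assumes v: "0 \<le> v" and s: "0 \<le> s"
  shows "v < s powr (1 / q) \<longleftrightarrow> v powr q < s"
proof
  assume "v < s powr (1 / q)"
  then have "v powr q < (s powr (1 / q)) powr q" using q v by (intro powr_less_mono2) auto
  then show "v powr q < s" using q s by (simp add: powr_powr)
next
  assume "v powr q < s"
  then have "(v powr q) powr (1 / q) < s powr (1 / q)" using q by (intro powr_less_mono2) auto
  then show "v < s powr (1 / q)" using q v by (simp add: powr_powr)
qed

lemma bdd_meas_Tq: "1 \<le> n \<Longrightarrow> bdd_meas (Tq n a)"
  by (simp add: Tq_def bdd_meas_rv)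

lemma distr_Tq:
  assumes "1 \<le> n" "\<And>z. 0 \<le> a z" "0 \<le> v"
  shows "distr (Tq n a) v = card {p. p permutes {..<n} \<and> v powr q < hit_sum n a p} / fact n"
  using assms by (simp add: Tq_def distr_rv less_powr_iff hit_sum_nonneg)

text \<open>Subadditivity of the \<open>q\<close>-th root followed by the triangle inequality: the
  matrix may be cut into parts at no loss of constant.\<close>

lemma norm_Tq_le_sum:
  assumes "1 \<le> n" "finite S" "\<And>z. 0 \<le> a z" "\<And>s z. 0 \<le> b s z"
    "\<And>z. a z \<le> (\<Sum>s\<in>S. b s z)"
  shows "N (Tq n a) \<le> (\<Sum>s\<in>S. N (Tq n (b s)))"
proof -
  have "N (Tq n a) \<le> N (rv n (\<lambda>p. \<Sum>s\<in>S. hit_sum n (b s) p powr (1 / q)))"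
    unfolding Tq_def
  proof (rule norm_rv_mono[OF assms(1)])
    fix p
    have "hit_sum n a p \<le> hit_sum n (\<lambda>z. \<Sum>s\<in>S. b s z) p"
      using assms(5) by (rule hit_sum_mono)
    also have "\<dots> = (\<Sum>s\<in>S. hit_sum n (b s) p)"
      unfolding hit_sum_def by (rule sum.swap)
    finally have "hit_sum n a p powr (1 / q) \<le> (\<Sum>s\<in>S. hit_sum n (b s) p) powr (1 / q)"
      using q assms(3) by (intro powr_mono2) (auto intro: hit_sum_nonneg)
    also have "\<dots> \<le> (\<Sum>s\<in>S. hit_sum n (b s) p powr (1 / q))"
      using q assms(2,4) by (intro powr_sum_le) (auto intro: hit_sum_nonneg)
    finally show "hit_sum n a p powr (1 / q) \<le> (\<Sum>s\<in>S. hit_sum n (b s) p powr (1 / q))" .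
  qed simp
  also have "\<dots> \<le> (\<Sum>s\<in>S. N (Tq n (b s)))"
    unfolding Tq_def by (rule norm_rv_sum_le[OF assms(1,2)])
  finally show ?thesis .
qed

lemma T_op_eq:
  assumes "x \<in> carrier_mat n n"
  shows "T_op (l n) q x = Tq n (\<lambda>z. \<bar>x $$ z\<bar> powr q)"
  using assms by (auto simp: T_op_def Tq_def rv_def step_def cell_def hit_sum_eq Let_def)

end

subsection \<open>The lower estimate\<close>

locale perm_ri_matrix = perm_ri_space +
  fixes n :: nat and x :: "real mat" and s :: "nat \<Rightarrow> nat \<times> nat"
  assumes n: "1 \<le> n" and x: "x \<in> carrier_mat n n"
    and s_bij: "bij_betw s {1..n\<^sup>2} ({..<n} \<times> {..<n})"
    and s_eq: "\<And>k. k \<in> {1..n\<^sup>2} \<Longrightarrow> \<bar>x $$ s k\<bar> = mat_rearr x k"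
    and antimono: "\<And>j k. 1 \<le> j \<Longrightarrow> j \<le> k \<Longrightarrow> k \<le> n\<^sup>2 \<Longrightarrow> mat_rearr x k \<le> mat_rearr x j"
begin

definition entry :: "nat \<times> nat \<Rightarrow> real" where
  "entry z = \<bar>x $$ z\<bar> powr q"

text \<open>The tail term of the equivalence before the \<open>q\<close>-th root is taken.\<close>

definition tail_mean :: real where
  "tail_mean = 1 / real n * (\<Sum>k=n+1..n\<^sup>2. mat_rearr x k powr q)"

lemma entry_nonneg: "0 \<le> entry z"
  by (simp add: entry_def)

lemma T_op_x: "T_op (l n) q x = Tq n entry"
  using T_op_eq[OF x] by (simp add: entry_def[abs_def])

lemma entry_s: "k \<in> {1..n\<^sup>2} \<Longrightarrow> entry (s k) = mat_rearr x k powr q"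
  by (simp add: entry_def s_eq)

lemma n_le: "n \<le> n\<^sup>2"
  by (simp add: power2_eq_square)

lemma rearr_nonneg: "k \<in> {1..n\<^sup>2} \<Longrightarrow> 0 \<le> mat_rearr x k"
  by (rule mat_rearr_nonneg[OF x])

lemma inj_s: "B \<subseteq> {1..n\<^sup>2} \<Longrightarrow> inj_on s B"
  using s_bij by (auto simp: bij_betw_def intro: inj_on_subset)

lemma s_image: "B \<subseteq> {1..n\<^sup>2} \<Longrightarrow> s ` B \<subseteq> {..<n} \<times> {..<n}"
  using s_bij by (auto simp: bij_betw_def)

text \<open>The \<open>k\<close> positions of \<open>U_op\<close> above level \<open>v\<close> are
  hit with probability at least \<open>k / (2 * n)\<close>, and a single hit lifts the hit sum above
  \<open>v powr q\<close>. Dilation by 2 makes up for the lost half.\<close>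

lemma norm_U_le: "N (U_op x) \<le> 2 * N (Tq n entry)"
proof -
  have "N (U_op x) \<le> real 2 * N (Tq n entry)"
  proof (rule norm_dilation_le[where n = n and w = "mat_rearr x"])
    fix v :: real assume v: "0 \<le> v"
    let ?B = "{k \<in> {1..n}. v < mat_rearr x k}"
    have B: "?B \<subseteq> {1..n\<^sup>2}" using n_le by auto
    have c: "card (s ` ?B) = card ?B" using inj_s[OF B] by (rule card_image)
    have "card ?B \<le> card {1..n}" by (rule card_mono) auto
    then have "real (card ?B) * fact (n - 1)
        \<le> 2 * real (card {p. p permutes {..<n} \<and> s ` ?B \<inter> graph_of n p \<noteq> {}})"
      using card_hit_set_ge[OF s_image[OF B]] unfolding c by simp
    also have "card {p. p permutes {..<n} \<and> s ` ?B \<inter> graph_of n p \<noteq> {}}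
        \<le> card {p. p permutes {..<n} \<and> v powr q < hit_sum n entry p}"
    proof (intro card_mono subsetI)
      fix p assume "p \<in> {p. p permutes {..<n} \<and> s ` ?B \<inter> graph_of n p \<noteq> {}}"
      then obtain k where k: "p permutes {..<n}" "k \<in> ?B" "s k \<in> graph_of n p" by blast
      then have "k \<in> {1..n\<^sup>2}" using B by blast
      then have "v powr q < entry (s k)"
        using q v k(2) by (auto simp: entry_s intro!: powr_less_mono2)
      also have "\<dots> \<le> hit_sum n entry p"
        unfolding hit_sum_def using k(3) by (intro member_le_sum) (auto simp: entry_nonneg)
      finally show "p \<in> {p. p permutes {..<n} \<and> v powr q < hit_sum n entry p}" using k(1) by simp
    qed (simp add: finite_permutations)
    finally have "real (card ?B) * fact (n - 1)
        \<le> 2 * real (card {p. p permutes {..<n} \<and> v powr q < hit_sum n entry p})" by simp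
    moreover have "fact n = real n * fact (n - 1)" using n by (intro fact_reduce) auto
    ultimately show "card ?B / (real 2 * real n) \<le> distr (Tq n entry) v"
      using n v by (simp add: distr_Tq entry_nonneg field_simps)
    show "distr (U_op x) v \<le> card ?B / n" by (simp add: distr_U_op[OF x v])
  qed (use n n_le x rearr_nonneg in \<open>auto intro: bdd_meas_U_op bdd_meas_Tq\<close>)
  then show ?thesis by simp
qed

lemma rearr_le_norm_U: "mat_rearr x n \<le> N (U_op x)"
proof -
  have 0: "0 \<le> mat_rearr x n" using n n_le by (intro rearr_nonneg) auto
  have "N (\<lambda>_. mat_rearr x n) \<le> N (U_op x)"
  proof (rule norm_le_of_distr)
    fix v :: real assume v: "0 \<le> v"
    show "distr (\<lambda>_. mat_rearr x n) v \<le> distr (U_op x) v"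
    proof (cases "v < mat_rearr x n")
      case True
      have "{k \<in> {1..n}. v < mat_rearr x k} = {1..n}"
        using antimono[of _ n] n_le True by (force intro: less_le_trans)
      then show ?thesis using n v 0 True by (simp add: distr_U_op[OF x v] distr_const)
    next
      case False
      then show ?thesis using v 0 by (simp add: distr_U_op[OF x v] distr_const)
    qed
  qed (auto intro: bdd_meas_U_op[OF x])
  then show ?thesis using 0 by (simp add: norm_const)
qed

lemma tail_mean_nonneg: "0 \<le> tail_mean"
  by (simp add: tail_mean_def sum_nonneg)

lemma entry_tail_le:
  assumes "k \<in> {n+1..n\<^sup>2}"
  shows "entry (s k) \<le> mat_rearr x n powr q"
proof -
  have k: "k \<in> {1..n\<^sup>2}" using assms by auto
  show ?thesis
    using q n assms rearr_nonneg[OF k] unfolding entry_s[OF k] by (intro powr_mono2 antimono) auto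
qed

text \<open>A tail mean below the \<open>q\<close>-th power of \<open>mat_rearr x n\<close> is
  controlled by \<open>U_op\<close>. Otherwise all tail entries lie below their mean, and half of it
  is exceeded with probability at least \<open>1 / 12\<close>. The constant is
  \<open>24 = 12 * 2\<close>, with 2 bounding \<open>2 powr (1 / q)\<close>.\<close>

lemma tail_mean_powr_le: "tail_mean powr (1 / q) \<le> 24 * N (Tq n entry)"
proof (cases "tail_mean \<le> mat_rearr x n powr q")
  case True
  have "tail_mean powr (1 / q) \<le> (mat_rearr x n powr q) powr (1 / q)"
    using True q tail_mean_nonneg by (intro powr_mono2) auto
  also have "\<dots> = mat_rearr x n"
    using q rearr_nonneg[of n] n n_le by (simp add: powr_powr)
  also have "\<dots> \<le> 2 * N (Tq n entry)" using rearr_le_norm_U norm_U_le by linarith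
  finally show ?thesis
    using norm_nonneg[OF bdd_meas_mem[OF bdd_meas_Tq[OF n, of entry]]] by simp
next
  case False
  let ?m = tail_mean and ?B = "{n+1..n\<^sup>2}"
  let ?b = "restr entry (s ` ?B)"
  have B: "?B \<subseteq> {1..n\<^sup>2}" by auto
  have m: "0 < ?m" using False powr_ge_zero[of "mat_rearr x n" q] by linarith
  have n2: "2 \<le> n"
  proof (rule ccontr)
    assume "\<not> 2 \<le> n"
    then have "n = 1" using n by simp
    then have "?B = {}" by simp
    then show False using m by (simp add: tail_mean_def)
  qed
  have b_le: "?b z \<le> ?m" for z
    using entry_tail_le False m by (force simp: restr_def)
  have b_nonneg: "0 \<le> ?b z" for z by (simp add: restr_def entry_nonneg)
  have "(\<Sum>z\<in>{..<n}\<times>{..<n}. ?b z) = (\<Sum>k\<in>?B. entry (s k))"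
    using inj_s[OF B] s_image[OF B] by (intro sum_restr_image) auto
  also have "\<dots> = (\<Sum>k\<in>?B. mat_rearr x k powr q)"
    using B by (intro sum.cong refl entry_s) auto
  also have "\<dots> = n * ?m" using n by (simp add: tail_mean_def)
  finally have "fact n \<le> 12 * real (card {p. p permutes {..<n} \<and> ?m / 2 < hit_sum n ?b p})"
    using card_hit_sum_gt_half_mean[OF b_nonneg b_le m _ n2] by simp
  also have "card {p. p permutes {..<n} \<and> ?m / 2 < hit_sum n ?b p}
      \<le> card {p. p permutes {..<n} \<and> ?m / 2 < hit_sum n entry p}"
  proof (intro card_mono subsetI)
    fix p assume "p \<in> {p. p permutes {..<n} \<and> ?m / 2 < hit_sum n ?b p}"
    moreover have "hit_sum n ?b p \<le> hit_sum n entry p"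
      by (rule hit_sum_mono) (simp add: restr_def entry_nonneg)
    ultimately show "p \<in> {p. p permutes {..<n} \<and> ?m / 2 < hit_sum n entry p}" by auto
  qed (simp add: finite_permutations)
  finally have card: "fact n \<le> 12 * real (card {p. p permutes {..<n} \<and> ?m / 2 < hit_sum n entry p})"
    by simp
  let ?c = "(?m / 2) powr (1 / q)"
  \<comment> \<open>The constant is treated as a step function with one cell and dilated by
    12.\<close>
  have "N (\<lambda>_. ?c) \<le> real 12 * N (Tq n entry)"
  proof (rule norm_dilation_le[where n = 1 and w = "\<lambda>_. ?c"])
    fix v :: real assume v: "0 \<le> v"
    show "distr (\<lambda>_. ?c) v \<le> card {k \<in> {1..1::nat}. v < ?c} / real 1"
      using v by (simp add: distr_const)
    show "card {k \<in> {1..1::nat}. v < ?c} / (real 12 * real 1) \<le> distr (Tq n entry) v"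
    proof (cases "v < ?c")
      case True
      then have "v powr q < ?m / 2" using v m by (simp add: less_powr_iff)
      then have "card {p. p permutes {..<n} \<and> ?m / 2 < hit_sum n entry p}
          \<le> card {p. p permutes {..<n} \<and> v powr q < hit_sum n entry p}"
        by (intro card_mono) (auto simp: finite_permutations)
      then have "fact n \<le> 12 * real (card {p. p permutes {..<n} \<and> v powr q < hit_sum n entry p})"
        using card by linarith
      then show ?thesis
        using n v True by (simp add: distr_Tq entry_nonneg field_simps)
    next
      case False
      then show ?thesis using n v by (simp add: distr_Tq entry_nonneg)
    qed
  qed (auto intro: bdd_meas_Tq[OF n])
  then have c: "?c \<le> 12 * N (Tq n entry)" by (simp add: norm_const)
  have "?m powr (1 / q) = 2 powr (1 / q) * ?c"
    using m by (simp add: powr_mult[symmetric])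
  also have "\<dots> \<le> 2 * ?c"
    using q powr_mono[of "1 / q" 1 2] by (intro mult_right_mono) auto
  finally show ?thesis using c by linarith
qed

end

subsection \<open>The upper estimate\<close>

context perm_ri_matrix
begin

text \<open>A position is hit with probability \<open>1 / n\<close>, the length of one interval of
  \<open>U_op\<close>. This serves \<open>n < 5\<close>, where blocks of \<open>n div 5\<close>
  entries are empty.\<close>

lemma norm_Tq_single_le:
  assumes k: "k \<in> {1..n}"
  shows "N (Tq n (restr entry {s k})) \<le> N (U_op x)"
proof (rule norm_le_of_distr[OF bdd_meas_Tq[OF n] bdd_meas_U_op[OF x]])
  fix v :: real assume v: "0 \<le> v"
  have k': "k \<in> {1..n\<^sup>2}" using k n_le by auto
  have hs: "hit_sum n (restr entry {s k}) p = (if s k \<in> graph_of n p then mat_rearr x k powr q else 0)" for p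
    using hit_sum_restr_image[of s "{k}" n entry p] by (auto simp: entry_s[OF k'] Collect_conv_if)
  have "real (card {p. p permutes {..<n} \<and> v powr q < hit_sum n (restr entry {s k}) p})
      \<le> (if v < mat_rearr x k then fact (n - 1) else 0)"
  proof (cases "v < mat_rearr x k")
    case True
    have "{p. p permutes {..<n} \<and> v powr q < hit_sum n (restr entry {s k}) p} \<subseteq> hits n {s k}"
      by (auto simp: hs hits_def split: if_splits)
    then have "card {p. p permutes {..<n} \<and> v powr q < hit_sum n (restr entry {s k}) p}
        \<le> card (hits n {s k})" by (intro card_mono) auto
    also have "\<dots> \<le> fact (n - 1)" using card_hits_le[of n "{s k}"] by simp
    finally have "real (card {p. p permutes {..<n} \<and> v powr q < hit_sum n (restr entry {s k}) p})
      \<le> real (fact (n - 1))" by (simp only: of_nat_le_iff)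
    then show ?thesis using True by simp
  next
    case False
    then have "mat_rearr x k powr q \<le> v powr q"
      using q rearr_nonneg[OF k'] by (intro powr_mono2) auto
    then have "\<not> v powr q < hit_sum n (restr entry {s k}) p" for p by (simp add: hs not_less)
    then show ?thesis by simp
  qed
  also have "\<dots> \<le> fact (n - 1) * real (card {k \<in> {1..n}. v < mat_rearr x k})"
  proof (cases "v < mat_rearr x k")
    case True
    then have "{k \<in> {1..n}. v < mat_rearr x k} \<noteq> {}" using k by blast
    then have "1 \<le> card {k \<in> {1..n}. v < mat_rearr x k}"
      using card_gt_0_iff[of "{k \<in> {1..n}. v < mat_rearr x k}"] by (simp add: Suc_le_eq)
    then show ?thesis using True by simp
  qed simp
  finally have "real (card {p. p permutes {..<n} \<and> v powr q < hit_sum n (restr entry {s k}) p})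
      \<le> fact (n - 1) * real (card {k \<in> {1..n}. v < mat_rearr x k})" .
  moreover have "fact n = real n * fact (n - 1)" using n by (intro fact_reduce) auto
  moreover have "0 \<le> restr entry {s k} z" for z by (simp add: restr_def entry_nonneg)
  ultimately show "distr (Tq n (restr entry {s k})) v \<le> distr (U_op x) v"
    using n v by (simp add: distr_Tq distr_U_op[OF x v] field_simps)
qed

text \<open>The block is compared with a diagonal matrix carrying the \<open>r\<close> largest
  values of \<open>x\<close>, whose \<open>U_op\<close> is then compared with that of
  \<open>x\<close> by a dilation.\<close>

lemma norm_Tq_block_le:
  assumes C: "0 \<le> C" "\<And>m y. 1 \<le> m \<Longrightarrow> y \<in> carrier_mat m m \<Longrightarrow> diagonal_mat y \<Longrightarrow>
      N (T_op (l m) q y) \<le> C * N (U_op y)"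
    and r: "1 \<le> r" "5 * r \<le> n" "n \<le> 10 * r" and b: "b + r \<le> n\<^sup>2"
  shows "N (Tq n (restr entry (s ` {b+1..b+r}))) \<le> 5 * C * N (U_op x)"
proof -
  define d where "d j = mat_rearr x (j + 1) powr q" for j
  \<comment> \<open>Half of the diagonal is zero: size \<open>2 * r\<close> keeps the fixed-point
    probabilities at the first \<open>r\<close> indices above the threshold.\<close>
  define y where "y = mat (2 * r) (2 * r) (\<lambda>(i, j). if i = j \<and> i < r then mat_rearr x (i + 1) else 0)"
  have y: "y \<in> carrier_mat (2 * r) (2 * r)" by (simp add: y_def)
  have r1: "1 \<le> 2 * r" using r by simp
  have rn: "r \<le> n\<^sup>2" using r(2) n_le by linarith
  have small: "j + 1 \<in> {1..n\<^sup>2}" if "j < r" for j using that rn by auto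
  have hs_y: "hit_sum (2 * r) (\<lambda>z. \<bar>y $$ z\<bar> powr q) p = (\<Sum>j | j < r \<and> p j = j. d j)"
    if p: "p permutes {..<2 * r}" for p
  proof -
    have "p i < 2 * r" if "i < 2 * r" for i using permutes_in_image[OF p, of i] that by simp
    then have "hit_sum (2 * r) (\<lambda>z. \<bar>y $$ z\<bar> powr q) p = (\<Sum>i<2 * r. if i < r \<and> p i = i then d i else 0)"
      unfolding hit_sum_eq using small rearr_nonneg
      by (intro sum.cong refl) (auto simp: y_def d_def simp del: atLeastAtMost_iff)
    also have "\<dots> = (\<Sum>j | j < r \<and> p j = j. d j)"
      by (intro sum.mono_neutral_cong_right) auto
    finally show ?thesis .
  qed
  have "N (Tq n (restr entry (s ` {b+1..b+r}))) \<le> N (T_op (l (2 * r)) q y)"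
    unfolding T_op_eq[OF y]
  proof (rule norm_le_of_distr[OF bdd_meas_Tq[OF n] bdd_meas_Tq[OF r1]])
    fix v :: real assume v: "0 \<le> v"
    let ?pos = "\<lambda>j. s (b + 1 + j)"
    have img: "s ` {b+1..b+r} = ?pos ` {..<r}"
    proof -
      have "{b+1..b+r} = (\<lambda>j. b + 1 + j) ` {..<r}"
      proof (intro equalityI subsetI)
        fix k assume "k \<in> {b+1..b+r}"
        then show "k \<in> (\<lambda>j. b + 1 + j) ` {..<r}" by (intro image_eqI[of _ _ "k - (b + 1)"]) auto
      qed auto
      then show ?thesis by (simp add: image_image)
    qed
    have inj: "inj_on ?pos {..<r}"
    proof -
      have "inj_on s ((\<lambda>j. b + 1 + j) ` {..<r})" using b by (intro inj_s) auto
      then have "inj_on (s \<circ> (\<lambda>j. b + 1 + j)) {..<r}"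
        by (rule comp_inj_on[rotated]) (simp add: inj_on_def)
      then show ?thesis by (simp add: o_def)
    qed
    \<comment> \<open>The entry of rank \<open>b + 1 + j\<close> is replaced by the larger one of
      rank \<open>j + 1\<close>.\<close>
    have le: "hit_sum n (restr entry (s ` {b+1..b+r})) p \<le> (\<Sum>j | j < r \<and> ?pos j \<in> graph_of n p. d j)" for p
    proof -
      have "hit_sum n (restr entry (s ` {b+1..b+r})) p
          = (\<Sum>j | j \<in> {..<r} \<and> ?pos j \<in> graph_of n p. entry (?pos j))"
        unfolding img using inj by (rule hit_sum_restr_image) simp
      also have "\<dots> = (\<Sum>j | j < r \<and> ?pos j \<in> graph_of n p. entry (?pos j))" by simp
      also have "\<dots> \<le> (\<Sum>j | j < r \<and> ?pos j \<in> graph_of n p. d j)"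
      proof (rule sum_mono)
        fix j assume "j \<in> {j. j < r \<and> ?pos j \<in> graph_of n p}"
        then have k: "b + 1 + j \<in> {1..n\<^sup>2}" and "j + 1 \<le> b + 1 + j" using b by auto
        then show "entry (?pos j) \<le> d j"
          unfolding entry_s[OF k] d_def using q rearr_nonneg[OF k]
          by (intro powr_mono2 antimono) auto
      qed
      finally show ?thesis .
    qed
    have "real (card {p. p permutes {..<n} \<and> v powr q < hit_sum n (restr entry (s ` {b+1..b+r})) p}) / fact n
      \<le> real (card {p. p permutes {..<n} \<and> v powr q < (\<Sum>j | j < r \<and> ?pos j \<in> graph_of n p. d j)}) / fact n"
      using le by (intro divide_right_mono of_nat_mono card_mono)
        (auto simp: finite_permutations intro: less_le_trans)
    also have "\<dots> \<le> real (card {p. p permutes {..<2 * r} \<and> v powr q < (\<Sum>j | j < r \<and> p j = j. d j)}) / fact (2 * r)"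
      by (rule block_dominated_by_diagonal[OF r(1,2) inj]) (simp add: d_def)
    also have "{p. p permutes {..<2 * r} \<and> v powr q < (\<Sum>j | j < r \<and> p j = j. d j)}
        = {p. p permutes {..<2 * r} \<and> v powr q < hit_sum (2 * r) (\<lambda>z. \<bar>y $$ z\<bar> powr q) p}"
      using hs_y by auto
    finally have card_le: "real (card {p. p permutes {..<n} \<and> v powr q < hit_sum n (restr entry (s ` {b+1..b+r})) p}) / fact n
      \<le> real (card {p. p permutes {..<2 * r} \<and> v powr q < hit_sum (2 * r) (\<lambda>z. \<bar>y $$ z\<bar> powr q) p}) / fact (2 * r)" .
    show "distr (Tq n (restr entry (s ` {b+1..b+r}))) v
        \<le> distr (Tq (2 * r) (\<lambda>z. \<bar>y $$ z\<bar> powr q)) v"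
    proof -
      have "0 \<le> restr entry (s ` {b+1..b+r}) z" for z by (simp add: restr_def entry_nonneg)
      then show ?thesis
        using card_le by (simp only: distr_Tq[OF n _ v] distr_Tq[OF r1 powr_ge_zero v])
    qed
  qed
  also have "\<dots> \<le> C * N (U_op y)"
    by (rule C(2)[OF r1 y]) (auto simp: y_def diagonal_mat_def)
  \<comment> \<open>The intervals for \<open>y\<close> have length \<open>1 / (2 * r)\<close>, at
    most \<open>5 / n\<close> since \<open>n \<le> 10 * r\<close>.\<close>
  also have "N (U_op y) \<le> real 5 * N (U_op x)"
  proof (rule norm_dilation_le[where n = "2 * r" and w = "\<lambda>k. if k \<le> r then mat_rearr x k else 0"])
    fix v :: real assume v: "0 \<le> v"
    let ?K = "{k \<in> {1..2 * r}. v < (if k \<le> r then mat_rearr x k else 0)}"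
    have "card {k \<in> {1..2 * r}. v < mat_rearr y k} \<le> card {k \<in> {1..(2 * r)\<^sup>2}. v < mat_rearr y k}"
      using self_le_power[OF r1, of 2] by (intro card_mono) auto
    also have "\<dots> = card {z \<in> {..<2 * r} \<times> {..<2 * r}. v < \<bar>y $$ z\<bar>}" by (rule card_mat_rearr[OF y])
    also have "\<dots> \<le> card ((\<lambda>k. (k - 1, k - 1)) ` ?K)"
    proof (intro card_mono subsetI)
      fix z assume z: "z \<in> {z \<in> {..<2 * r} \<times> {..<2 * r}. v < \<bar>y $$ z\<bar>}"
      then obtain i j where ij: "z = (i, j)" "i < 2 * r" "j < 2 * r" by auto
      with z v have *: "i = j" "i < r" "v < \<bar>mat_rearr x (i + 1)\<bar>"
        by (auto simp: y_def split: if_splits)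
      then have "v < mat_rearr x (i + 1)" using rearr_nonneg[OF small[OF *(2)]] by simp
      then have "i + 1 \<in> ?K" using * by auto
      then show "z \<in> (\<lambda>k. (k - 1, k - 1)) ` ?K" using ij *(1) by (auto intro!: image_eqI[of _ _ "i + 1"])
    qed simp
    also have "\<dots> \<le> card ?K" by (rule card_image_le) simp
    finally show "distr (U_op y) v \<le> card ?K / real (2 * r)"
      using r by (simp add: distr_U_op[OF y v] divide_right_mono)
    have "?K \<subseteq> {k \<in> {1..n}. v < mat_rearr x k}" using r v by (auto split: if_splits)
    then have "card ?K \<le> card {k \<in> {1..n}. v < mat_rearr x k}" by (intro card_mono) auto
    then have "card ?K / (real 5 * real (2 * r)) \<le> card {k \<in> {1..n}. v < mat_rearr x k} / n"
      using r n by (intro frac_le) auto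
    then show "card ?K / (real 5 * real (2 * r)) \<le> distr (U_op x) v"
      by (simp add: distr_U_op[OF x v])
  qed (use r1 small rearr_nonneg bdd_meas_U_op[OF x] bdd_meas_U_op[OF y] rn in auto)
  finally show ?thesis using C(1) by (simp add: mult_left_mono)
qed

text \<open>For \<open>5 \<le> n\<close>, ten blocks of \<open>n div 5\<close> entries reach at
  least to rank \<open>n\<close>, and each costs \<open>5 * C\<close>. For smaller \<open>n\<close>
  at most four single entries account for the 4.\<close>

lemma norm_Tq_top_le:
  assumes C: "0 \<le> C" "\<And>m y. 1 \<le> m \<Longrightarrow> y \<in> carrier_mat m m \<Longrightarrow> diagonal_mat y \<Longrightarrow>
      N (T_op (l m) q y) \<le> C * N (U_op y)"
  obtains L where "n \<le> L" "L \<le> n\<^sup>2"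
    "N (Tq n (restr entry (s ` {1..L}))) \<le> (50 * C + 4) * N (U_op x)"
proof -
  have U0: "0 \<le> N (U_op x)" by (intro norm_nonneg bdd_meas_mem bdd_meas_U_op[OF x])
  show ?thesis
  proof (cases "n < 5")
    case True
    have "N (Tq n (restr entry (s ` {1..n}))) \<le> (\<Sum>k\<in>{1..n}. N (Tq n (restr entry {s k})))"
    proof (rule norm_Tq_le_sum[OF n])
      fix z
      show "restr entry (s ` {1..n}) z \<le> (\<Sum>k\<in>{1..n}. restr entry {s k} z)"
      proof (cases "z \<in> s ` {1..n}")
        case True
        then obtain k where "k \<in> {1..n}" "z = s k" by blast
        then have "restr entry (s ` {1..n}) z = restr entry {s k} z" by (auto simp: restr_def)
        also have "\<dots> \<le> (\<Sum>k\<in>{1..n}. restr entry {s k} z)"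
          using \<open>k \<in> {1..n}\<close> by (intro member_le_sum) (auto simp: restr_def entry_nonneg)
        finally show ?thesis .
      qed (auto simp: restr_def entry_nonneg intro!: sum_nonneg)
    qed (auto simp: restr_def entry_nonneg)
    also have "\<dots> \<le> (\<Sum>k\<in>{1..n}. N (U_op x))"
      by (intro sum_mono norm_Tq_single_le)
    also have "\<dots> \<le> 4 * N (U_op x)" using True U0 by (simp add: mult_right_mono)
    also have "\<dots> \<le> (50 * C + 4) * N (U_op x)" using C(1) U0 by (intro mult_right_mono) auto
    finally show ?thesis using that[of n] n_le by simp
  next
    case False
    define r where "r = n div 5"
    have r: "1 \<le> r" "5 * r \<le> n" "n \<le> 10 * r"
    proof -
      show "1 \<le> r" "5 * r \<le> n" using False by (auto simp: r_def)
      have "n < 5 * r + 5" unfolding r_def using div_mult_mod_eq[of n 5] mod_less_divisor[of 5 n] by linarith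
      with \<open>1 \<le> r\<close> show "n \<le> 10 * r" by linarith
    qed
    have "2 * n \<le> n * n" using False by (intro mult_right_mono) auto
    then have L: "10 * r \<le> n\<^sup>2" using r(2) unfolding power2_eq_square by linarith
    have "N (Tq n (restr entry (s ` {1..10 * r})))
        \<le> (\<Sum>t<10::nat. N (Tq n (restr entry (s ` {t * r + 1..t * r + r}))))"
    proof (rule norm_Tq_le_sum[OF n])
      fix z
      show "restr entry (s ` {1..10 * r}) z \<le> (\<Sum>t<10::nat. restr entry (s ` {t * r + 1..t * r + r}) z)"
      proof (cases "z \<in> s ` {1..10 * r}")
        case True
        then obtain k where k: "k \<in> {1..10 * r}" "z = s k" by blast
        \<comment> \<open>The block that contains rank \<open>k\<close>, with ranks counted from
          1.\<close>
        define t where "t = (k - 1) div r"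
        have "k - 1 < 10 * r" using k by auto
        then have t: "t < 10" unfolding t_def using r by (simp add: div_less_iff_less_mult)
        have "k - 1 = t * r + (k - 1) mod r" "(k - 1) mod r < r" unfolding t_def using r by auto
        then have "k \<in> {t * r + 1..t * r + r}" using k(1) unfolding atLeastAtMost_iff by linarith
        then have "restr entry (s ` {1..10 * r}) z = restr entry (s ` {t * r + 1..t * r + r}) z"
          using k by (auto simp: restr_def)
        also have "\<dots> \<le> (\<Sum>t<10::nat. restr entry (s ` {t * r + 1..t * r + r}) z)"
          using t by (intro member_le_sum) (auto simp: restr_def entry_nonneg)
        finally show ?thesis .
      qed (auto simp: restr_def entry_nonneg intro!: sum_nonneg)
    qed (auto simp: restr_def entry_nonneg)
    also have "\<dots> \<le> (\<Sum>t<10::nat. 5 * C * N (U_op x))"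
    proof (rule sum_mono)
      fix t :: nat assume "t \<in> {..<10}"
      then have "(t + 1) * r \<le> 10 * r" by (intro mult_right_mono) auto
      then have "t * r + r \<le> n\<^sup>2" using L unfolding add_mult_distrib by linarith
      then show "N (Tq n (restr entry (s ` {t * r + 1..t * r + r}))) \<le> 5 * C * N (U_op x)"
        by (rule norm_Tq_block_le[OF C r, rotated -1])
    qed
    also have "\<dots> \<le> (50 * C + 4) * N (U_op x)" using U0 by (simp add: algebra_simps)
    finally show ?thesis using that[of "10 * r"] r L by simp
  qed
qed

text \<open>Division by \<open>M\<close> makes the entries at most 1 and their sum at most
  \<open>n\<close>, as the comparison with fixed points demands; the root of \<open>M\<close> is
  bounded by the two terms on the right.\<close>

lemma norm_Tq_tail_le:
  assumes C: "\<And>m y. 1 \<le> m \<Longrightarrow> y \<in> carrier_mat m m \<Longrightarrow> diagonal_mat y \<Longrightarrow>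
      N (T_op (l m) q y) \<le> C * N (U_op y)" "0 \<le> C"
    and B: "B \<subseteq> {n+1..n\<^sup>2}"
  shows "N (Tq n (restr entry (s ` B))) \<le> 17 * (C + 1) * (N (U_op x) + tail_mean powr (1 / q))"
proof -
  define M where "M = max (mat_rearr x n powr q) tail_mean"
  define b where "b z = restr entry (s ` B) z / M" for z
  define fixpts where "fixpts p = card {i. i < n \<and> p i = i}" for p
  have M0: "0 \<le> M" by (simp add: M_def le_max_iff_disj)
  have B': "B \<subseteq> {1..n\<^sup>2}" using B by auto
  have finB: "finite B" using B finite_subset by blast
  have restr_le: "restr entry (s ` B) z \<le> M" for z
    using entry_tail_le B M0 by (force simp: restr_def M_def le_max_iff_disj)
  \<comment> \<open>For \<open>M = 0\<close> the division yields 0, but the restricted entries are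
    then 0 as well.\<close>
  have eq: "restr entry (s ` B) z = M * b z" for z
    using restr_le[of z] M0 by (cases "M = 0") (auto simp: b_def restr_def entry_nonneg antisym)
  have b0: "0 \<le> b z" and b1: "b z \<le> 1" for z
    using restr_le[of z] M0 by (auto simp: b_def restr_def entry_nonneg divide_le_eq)
  have bsum: "(\<Sum>z\<in>{..<n}\<times>{..<n}. b z) \<le> n"
  proof -
    have "(\<Sum>z\<in>{..<n}\<times>{..<n}. restr entry (s ` B) z) = (\<Sum>k\<in>B. entry (s k))"
      using inj_s[OF B'] s_image[OF B'] by (intro sum_restr_image) auto
    also have "\<dots> \<le> (\<Sum>k=n+1..n\<^sup>2. entry (s k))"
      using B by (intro sum_mono2) (auto simp: entry_nonneg)
    also have "\<dots> = (\<Sum>k=n+1..n\<^sup>2. mat_rearr x k powr q)"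
      by (intro sum.cong refl entry_s) auto
    also have "\<dots> = n * tail_mean" using n by (simp add: tail_mean_def)
    also have "\<dots> \<le> n * M" by (intro mult_left_mono) (auto simp: M_def)
    finally have "(\<Sum>z\<in>{..<n}\<times>{..<n}. restr entry (s ` B) z) / M \<le> n"
      using M0 by (cases "M = 0") (auto simp: divide_le_eq)
    then show ?thesis by (simp add: b_def sum_divide_distrib)
  qed
  \<comment> \<open>Here the hypothesis is applied to the identity matrix, whose \<open>U_op\<close>
    has norm at most 1.\<close>
  have fixpts_norm: "N (rv n (\<lambda>p. fixpts p powr (1 / q))) \<le> C"
  proof -
    have one: "1\<^sub>m n \<in> carrier_mat n n" by simp
    have "N (rv n (\<lambda>p. fixpts p powr (1 / q))) \<le> N (T_op (l n) q (1\<^sub>m n))"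
      unfolding T_op_eq[OF one] Tq_def
    proof (rule norm_rv_le[OF n n])
      fix v :: real
      have "hit_sum n (\<lambda>z. \<bar>1\<^sub>m n $$ z\<bar> powr q) p = fixpts p" if p: "p permutes {..<n}" for p
      proof -
        have "p i < n" if "i < n" for i using permutes_in_image[OF p, of i] that by simp
        then have "hit_sum n (\<lambda>z. \<bar>1\<^sub>m n $$ z\<bar> powr q) p = (\<Sum>i<n. of_bool (p i = i))"
          unfolding hit_sum_eq by (intro sum.cong refl) auto
        then show ?thesis by (simp add: fixpts_def Int_def)
      qed
      then have "{p. p permutes {..<n} \<and> v < fixpts p powr (1 / q)}
          = {p. p permutes {..<n} \<and> v < hit_sum n (\<lambda>z. \<bar>1\<^sub>m n $$ z\<bar> powr q) p powr (1 / q)}" by auto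
      then show "real (card {p. p permutes {..<n} \<and> v < fixpts p powr (1 / q)}) / fact n
        \<le> real (card {p. p permutes {..<n} \<and> v < hit_sum n (\<lambda>z. \<bar>1\<^sub>m n $$ z\<bar> powr q) p powr (1 / q)}) / fact n"
        by simp
    qed auto
    also have "\<dots> \<le> C * N (U_op (1\<^sub>m n))"
      by (rule C(1)[OF n one]) (simp add: diagonal_mat_def)
    also have "\<dots> \<le> C * 1"
    proof (intro mult_left_mono C(2))
      have "N (U_op (1\<^sub>m n)) \<le> N (\<lambda>_. 1)"
      proof (rule norm_le_of_distr[OF bdd_meas_U_op[OF one] bdd_meas_const])
        fix v :: real assume v: "0 \<le> v"
        show "distr (U_op (1\<^sub>m n)) v \<le> distr (\<lambda>_. 1) v"
        proof (cases "v < 1")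
          case True
          have "card {k \<in> {1..n}. v < mat_rearr (1\<^sub>m n) k} \<le> card {1..n}" by (rule card_mono) auto
          then show ?thesis using True v n by (simp add: distr_U_op[OF one v] distr_const)
        next
          case False
          have "card {k \<in> {1..n}. v < mat_rearr (1\<^sub>m n) k} \<le> card {k \<in> {1..n\<^sup>2}. v < mat_rearr (1\<^sub>m n) k}"
            using n_le by (intro card_mono) auto
          also have "\<dots> = card {z \<in> {..<n} \<times> {..<n}. v < \<bar>(1\<^sub>m n :: real mat) $$ z\<bar>}"
            by (rule card_mat_rearr[OF one])
          also have "{z \<in> {..<n} \<times> {..<n}. v < \<bar>(1\<^sub>m n :: real mat) $$ z\<bar>} = {}"
            using False v by (auto split: if_splits)
          finally have "card {k \<in> {1..n}. v < mat_rearr (1\<^sub>m n) k} = 0" by simp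
          then have "distr (U_op (1\<^sub>m n)) v = 0"
            unfolding distr_U_op[OF one v] by (simp only: of_nat_0 div_0)
          then show ?thesis using False v by (simp add: distr_const)
        qed
      qed
      then show "N (U_op (1\<^sub>m n)) \<le> 1" by (simp add: norm_one)
    qed
    finally show ?thesis by simp
  qed
  have b_norm: "N (Tq n b) \<le> 17 * (C + 1)"
  proof -
    \<comment> \<open>The sum over truth values encodes \<open>fixpts p powr (1 / q) + 1\<close>,
      ready for \<open>norm_rv_sum_le\<close>.\<close>
    have "N (Tq n b) \<le> N (rv n (\<lambda>p. 17 * (\<Sum>i\<in>{True, False}. if i then fixpts p powr (1 / q) else 1)))"
      unfolding Tq_def
    proof (rule norm_rv_le[OF n n])
      fix v :: real assume v: "0 \<le> v"
      \<comment> \<open>Rounding down to a multiple of 17 costs less than 17, which the added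
        constant 1 pays for.\<close>
      define k where "k = nat \<lfloor>v powr q / 17\<rfloor>"
      have k: "17 * real k \<le> v powr q" "v powr q < 17 * (real k + 1)"
      proof -
        have "real k = of_int \<lfloor>v powr q / 17\<rfloor>" by (simp add: k_def)
        then have "real k \<le> v powr q / 17" "v powr q / 17 < real k + 1"
          using of_int_floor_le[of "v powr q / 17"] real_of_int_floor_add_one_gt[of "v powr q / 17"]
          by (simp_all only:)
        then show "17 * real k \<le> v powr q" "v powr q < 17 * (real k + 1)"
          by (simp_all add: field_simps)
      qed
      have "card {p. p permutes {..<n} \<and> v < hit_sum n b p powr (1 / q)}
          \<le> card {p. p permutes {..<n} \<and> 17 * real k \<le> hit_sum n b p}"
        using k(1) v by (intro card_mono) (auto simp: finite_permutations less_powr_iff hit_sum_nonneg b0)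
      also have "\<dots> \<le> card {p. p permutes {..<n} \<and> k \<le> fixpts p}"
        unfolding fixpts_def by (rule card_hit_sum_le_fixpoints[OF b0 b1 bsum])
      also have "\<dots> \<le> card {p. p permutes {..<n} \<and> v < 17 * (fixpts p powr (1 / q) + 1)}"
      proof (intro card_mono subsetI)
        fix p assume p: "p \<in> {p. p permutes {..<n} \<and> k \<le> fixpts p}"
        then have "17 * (real k + 1) \<le> 17 * (real (fixpts p) + 1)" by simp
        with k(2) have "v powr q < 17 * (real (fixpts p) + 1)" by linarith
        then have "v < (17 * (real (fixpts p) + 1)) powr (1 / q)"
          using v by (simp add: less_powr_iff)
        also have "\<dots> = 17 powr (1 / q) * (real (fixpts p) + 1) powr (1 / q)"
          by (rule powr_mult)
        also have "\<dots> \<le> 17 powr 1 * (fixpts p powr (1 / q) + 1 powr (1 / q))"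
          using q by (intro mult_mono powr_add_le powr_mono) auto
        finally show "p \<in> {p. p permutes {..<n} \<and> v < 17 * (fixpts p powr (1 / q) + 1)}" using p by simp
      qed (simp add: finite_permutations)
      finally show "real (card {p. p permutes {..<n} \<and> v < hit_sum n b p powr (1 / q)}) / fact n
          \<le> real (card {p. p permutes {..<n} \<and> v < 17 * (\<Sum>i\<in>{True, False}. if i then fixpts p powr (1 / q) else 1)}) / fact n"
        by (simp add: divide_right_mono)
    qed auto
    also have "\<dots> = 17 * N (rv n (\<lambda>p. \<Sum>i\<in>{True, False}. if i then fixpts p powr (1 / q) else 1))"
      by (subst norm_rv_scale[OF n]) simp
    also have "\<dots> \<le> 17 * (\<Sum>i\<in>{True, False}. N (rv n (\<lambda>p. if i then fixpts p powr (1 / q) else 1)))"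
      by (intro mult_left_mono norm_rv_sum_le[OF n]) auto
    also have "\<dots> \<le> 17 * (C + 1)"
      using fixpts_norm norm_rv_one_le[OF n] by simp
    finally show ?thesis .
  qed
  have M_le: "M powr (1 / q) \<le> N (U_op x) + tail_mean powr (1 / q)"
  proof (cases "mat_rearr x n powr q \<le> tail_mean")
    case True
    then show ?thesis
      using norm_nonneg[OF bdd_meas_mem[OF bdd_meas_U_op[OF x]]] by (simp add: M_def max_absorb2)
  next
    case False
    have "(mat_rearr x n powr q) powr (1 / q) = mat_rearr x n"
      using q rearr_nonneg[of n] n n_le by (simp add: powr_powr)
    then show ?thesis using False rearr_le_norm_U by (simp add: M_def add_increasing2)
  qed
  have "Tq n (restr entry (s ` B)) = rv n (\<lambda>p. M powr (1 / q) * hit_sum n b p powr (1 / q))"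
  proof -
    have "hit_sum n (restr entry (s ` B)) p = M * hit_sum n b p" for p
      by (simp add: hit_sum_def eq sum_distrib_left)
    then show ?thesis using M0 b0 by (simp add: Tq_def powr_mult hit_sum_nonneg)
  qed
  then have "N (Tq n (restr entry (s ` B))) = M powr (1 / q) * N (Tq n b)"
    by (simp add: norm_rv_scale[OF n] Tq_def)
  also have "\<dots> \<le> (N (U_op x) + tail_mean powr (1 / q)) * (17 * (C + 1))"
    using M_le b_norm norm_nonneg[OF bdd_meas_mem[OF bdd_meas_Tq[OF n, of b]]] powr_ge_zero[of M "1 / q"]
    by (intro mult_mono) linarith+
  finally show ?thesis by (simp add: algebra_simps)
qed

text \<open>Adding the estimates for the ranks up to \<open>L\<close> and beyond gives
  \<open>67 = 50 + 17\<close> and \<open>21 = 4 + 17\<close>.\<close>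

lemma norm_Tq_entry_le:
  assumes C: "0 \<le> C" "\<And>m y. 1 \<le> m \<Longrightarrow> y \<in> carrier_mat m m \<Longrightarrow> diagonal_mat y \<Longrightarrow>
      N (T_op (l m) q y) \<le> C * N (U_op y)"
  shows "N (Tq n entry) \<le> (67 * C + 21) * (N (U_op x) + tail_mean powr (1 / q))"
proof -
  obtain L where L: "n \<le> L" "L \<le> n\<^sup>2"
    and top: "N (Tq n (restr entry (s ` {1..L}))) \<le> (50 * C + 4) * N (U_op x)"
    using norm_Tq_top_le[OF C] by blast
  define B where "B i = (if i then {1..L} else {L+1..n\<^sup>2})" for i
  \<comment> \<open>\<open>entry\<close> is unspecified outside the matrix; \<open>a\<close> is 0
    there and agrees with it along permutations.\<close>
  define a where "a = restr entry (s ` {1..n\<^sup>2})"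
  have "N (Tq n entry) = N (Tq n a)"
  proof -
    have img: "s ` {1..n\<^sup>2} = {..<n} \<times> {..<n}" using s_bij by (simp add: bij_betw_def)
    have "hit_sum n entry p = hit_sum n a p" if "p permutes {..<n}" for p
      unfolding hit_sum_def a_def using graph_of_subset[OF that] img
      by (intro sum.cong refl) (auto simp: restr_def)
    then have "Tq n entry = Tq n a"
      unfolding Tq_def rv_def step_def by (intro ext sum.cong) auto
    then show ?thesis by simp
  qed
  also have "\<dots> \<le> (\<Sum>i\<in>{True, False}. N (Tq n (restr entry (s ` B i))))"
  proof (rule norm_Tq_le_sum[OF n])
    fix z
    have "{1..n\<^sup>2} \<subseteq> B True \<union> B False" by (auto simp: B_def)
    then have "s ` {1..n\<^sup>2} \<subseteq> s ` B True \<union> s ` B False" by blast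
    then show "a z \<le> (\<Sum>i\<in>{True, False}. restr entry (s ` B i) z)"
      using entry_nonneg[of z] by (auto simp: a_def restr_def)
  qed (auto simp: a_def restr_def entry_nonneg)
  also have "\<dots> \<le> (50 * C + 4) * N (U_op x) + 17 * (C + 1) * (N (U_op x) + tail_mean powr (1 / q))"
    using top norm_Tq_tail_le[OF C(2,1), of "{L+1..n\<^sup>2}"] L by (simp add: B_def)
  also have "\<dots> \<le> (50 * C + 4) * (N (U_op x) + tail_mean powr (1 / q))
      + 17 * (C + 1) * (N (U_op x) + tail_mean powr (1 / q))"
    using C(1) by (intro add_right_mono mult_left_mono) auto
  finally show ?thesis by (simp add: algebra_simps)
qed

end

section \<open>Diagonal matrices and the equivalence\<close>

text \<open>A positive value at a rank beyond \<open>n\<close> would give more than \<open>n\<close>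
  nonzero positions, but the diagonal has only \<open>n\<close>.\<close>

lemma diagonal_mat_rearr_eq_0:
  assumes y: "y \<in> carrier_mat n n" and "diagonal_mat y" and k: "k \<in> {n+1..n\<^sup>2}"
  shows "mat_rearr y k = 0"
proof (rule ccontr)
  assume "mat_rearr y k \<noteq> 0"
  then have pos: "0 < mat_rearr y k" using mat_rearr_nonneg[OF y, of k] k by auto
  have "{1..k} \<subseteq> {j \<in> {1..n\<^sup>2}. 0 < mat_rearr y j}"
    using mat_rearr_enumeration[OF y] k pos
    by (smt (verit) atLeastAtMost_iff mem_Collect_eq subsetI order_trans)
  then have "card {1..k} \<le> card {j \<in> {1..n\<^sup>2}. 0 < mat_rearr y j}" by (intro card_mono) auto
  also have "\<dots> = card {z \<in> {..<n} \<times> {..<n}. 0 < \<bar>y $$ z\<bar>}" by (rule card_mat_rearr[OF y])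
  also have "\<dots> \<le> card ((\<lambda>i. (i, i)) ` {..<n})"
  proof (intro card_mono subsetI)
    fix z assume "z \<in> {z \<in> {..<n} \<times> {..<n}. 0 < \<bar>y $$ z\<bar>}"
    then obtain i j where z: "z = (i, j)" "i < n" "j < n" "y $$ (i, j) \<noteq> 0" by auto
    then have "i = j" using y \<open>diagonal_mat y\<close> unfolding diagonal_mat_def by fastforce
    with z show "z \<in> (\<lambda>i. (i, i)) ` {..<n}" by simp
  qed simp
  also have "\<dots> \<le> n" using card_image_le[of "{..<n}" "\<lambda>i. (i, i)"] by simp
  finally show False using k by simp
qed

theorem corollary8:
  fixes E :: "(real \<Rightarrow> real) set" and N :: "(real \<Rightarrow> real) \<Rightarrow> real"
    and q :: real and l :: "nat \<Rightarrow> (nat \<Rightarrow> nat) \<Rightarrow> nat"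
  assumes "ri_space E N"
    and "(\<lambda>_. 1) \<in> E" and "N (\<lambda>_. 1) = 1"
    and "maximal_space E N \<or> minimal_space E N"
    and "1 \<le> q"
    and "\<And>n. n \<ge> 1 \<Longrightarrow> bij_betw (l n) {p. p permutes {..<n}} {1..fact n}"
  shows "(\<exists>c>0. \<exists>C>0. \<forall>n\<ge>1. \<forall>x \<in> carrier_mat n n.
            c * (N (U_op x) + (1 / real n * (\<Sum>k=n+1..n^2. mat_rearr x k powr q)) powr (1 / q))
              \<le> N (T_op (l n) q x) \<and>
            N (T_op (l n) q x)
              \<le> C * (N (U_op x) + (1 / real n * (\<Sum>k=n+1..n^2. mat_rearr x k powr q)) powr (1 / q)))
    \<longleftrightarrow>
         (\<exists>C. \<forall>n\<ge>1. \<forall>y \<in> carrier_mat n n. diagonal_mat y \<longrightarrow>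
            N (T_op (l n) q y) \<le> C * N (U_op y))"
    (is "(\<exists>c>0. \<exists>C>0. ?equiv c C) \<longleftrightarrow> (\<exists>C. ?diag C)")
proof -
  interpret unital_ri_space E N
    using assms(1-3) by (simp add: unital_ri_space_def unital_ri_space_axioms_def)
  interpret perm_ri_space E N l q
    by standard (use assms(5,6) in auto)
  show ?thesis
  proof
    assume "\<exists>c>0. \<exists>C>0. ?equiv c C"
    then obtain c C where cC: "?equiv c C" by blast
    \<comment> \<open>The tail of a diagonal matrix vanishes, so the upper half of the equivalence
      is the diagonal bound.\<close>
    have "?diag C"
    proof (intro allI impI ballI)
      fix n :: nat and y :: "real mat"
      assume y: "1 \<le> n" "y \<in> carrier_mat n n" "diagonal_mat y"
      have "(\<Sum>k=n+1..n^2. mat_rearr y k powr q) = 0"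
        by (intro sum.neutral ballI) (simp add: diagonal_mat_rearr_eq_0[OF y(2,3)])
      then show "N (T_op (l n) q y) \<le> C * N (U_op y)"
        using cC[rule_format, OF y(1,2)] by simp
    qed
    then show "\<exists>C. ?diag C" ..
  next
    assume "\<exists>C. ?diag C"
    then obtain C0 where C0: "?diag C0" by blast
    define C where "C = max C0 0"
    have C: "0 \<le> C" by (simp add: C_def)
    have diag: "N (T_op (l m) q y) \<le> C * N (U_op y)"
      if y: "1 \<le> m" "y \<in> carrier_mat m m" "diagonal_mat y" for m y
    proof -
      have "N (T_op (l m) q y) \<le> C0 * N (U_op y)" using C0 y by blast
      also have "\<dots> \<le> C * N (U_op y)"
        using norm_nonneg[OF bdd_meas_mem[OF bdd_meas_U_op[OF y(2)]]]
        by (intro mult_right_mono) (auto simp: C_def)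
      finally show ?thesis .
    qed
    \<comment> \<open>The lower constant adds both lower estimates:
      \<open>26 = 2 + 24\<close>.\<close>
    have "?equiv (1 / 26) (67 * C + 21)"
    proof (intro allI impI ballI)
      fix n :: nat and x :: "real mat"
      assume n: "1 \<le> n" and x: "x \<in> carrier_mat n n"
      obtain s where s: "bij_betw s {1..n\<^sup>2} ({..<n} \<times> {..<n})"
        "\<And>k. k \<in> {1..n\<^sup>2} \<Longrightarrow> \<bar>x $$ s k\<bar> = mat_rearr x k"
        "\<And>j k. 1 \<le> j \<Longrightarrow> j \<le> k \<Longrightarrow> k \<le> n\<^sup>2 \<Longrightarrow> mat_rearr x k \<le> mat_rearr x j"
        using mat_rearr_enumeration[OF x] by metis
      interpret perm_ri_matrix E N l q n x s
        by standard (use n x s in auto)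
      show "1 / 26 * (N (U_op x) + (1 / real n * (\<Sum>k=n+1..n^2. mat_rearr x k powr q)) powr (1 / q))
              \<le> N (T_op (l n) q x) \<and>
            N (T_op (l n) q x)
              \<le> (67 * C + 21) * (N (U_op x) + (1 / real n * (\<Sum>k=n+1..n^2. mat_rearr x k powr q)) powr (1 / q))"
        unfolding tail_mean_def[symmetric] T_op_x
        using norm_U_le tail_mean_powr_le norm_Tq_entry_le[OF C diag] by simp
    qed
    moreover have "0 < (1 / 26 :: real)" "0 < 67 * C + 21" using C by auto
    ultimately show "\<exists>c>0. \<exists>C>0. ?equiv c C" by blast
  qed
qed

end
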